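(* (1) Every scattered metrizable space $X$ has a compactification $K$ that is scattered and hereditarily paracompact. (2) Every scattered hereditarily paracompact compact Hausdorff space is uniform Eberlein. (3) A compact Hausdorff space $X$ is scattered and hereditarily paracompact if and only if $X$ belongs to the class $\mathcal A$.
   Context: A topological space is scattered if each nonempty subspace has an isolated point. A compact space is uniform Eberlein if it is homeomorphic to a compact subset of a Hilbert space endowed with its weak topology. A compactification of $X$ is a compact Hausdorff space containing $X$ as a dense subspace. For a locally compact Hausdorff space $Y$, an Aleksandrov compactification of $Y$ is a compactification $\overline Y$ of $Y$ with $|\overline Y\setminus Y|\le 1$ (so if $Y$ is compact it is $Y$ itself). The class $\mathcal A$ is the smallest class of compact spaces that contains the empty space and the one-point space and is closed under taking the Aleksandrov compactification of a topological sum $\bigoplus_{i\in I}K_i$ of any family $\{K_i\}_{i\in I}$ of spaces from $\mathcal A$. *)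

theory Defs
  imports "HOL-Analysis.Analysis"
begin

definition scattered_space :: "'a topology \<Rightarrow> bool" where
  "scattered_space X \<longleftrightarrow>
     (\<forall>S. S \<subseteq> topspace X \<and> S \<noteq> {} \<longrightarrow>
        (\<exists>x\<in>S. \<exists>U. openin X U \<and> U \<inter> S = {x}))"

definition paracompact_space :: "'a topology \<Rightarrow> bool" where
  "paracompact_space X \<longleftrightarrow> Hausdorff_space X \<and>
     (\<forall>\<U>. (\<forall>U\<in>\<U>. openin X U) \<and> \<Union>\<U> = topspace X \<longrightarrow>
        (\<exists>\<V>. (\<forall>V\<in>\<V>. openin X V) \<and> \<Union>\<V> = topspace X \<and>
             (\<forall>V\<in>\<V>. \<exists>U\<in>\<U>. V \<subseteq> U) \<and> locally_finite_in X \<V>))"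

definition hereditarily_paracompact :: "'a topology \<Rightarrow> bool" where
  "hereditarily_paracompact X \<longleftrightarrow>
     (\<forall>S. S \<subseteq> topspace X \<longrightarrow> paracompact_space (subtopology X S))"

definition compactification :: "'a topology \<Rightarrow> 'b topology \<Rightarrow> ('a \<Rightarrow> 'b) \<Rightarrow> bool" where
  "compactification X K e \<longleftrightarrow> compact_space K \<and> Hausdorff_space K \<and>
     embedding_map X K e \<and> K closure_of (e ` topspace X) = topspace K"

definition l2_space :: "('i \<Rightarrow> real) set" where
  "l2_space = {x. (\<lambda>i. (x i)\<^sup>2) summable_on UNIV}"

definition l2_inner :: "('i \<Rightarrow> real) \<Rightarrow> ('i \<Rightarrow> real) \<Rightarrow> real" where
  "l2_inner x y = (\<Sum>\<^sub>\<infinity>i. x i * y i)"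

definition l2_weak_topology :: "('i \<Rightarrow> real) topology" where
  "l2_weak_topology = topology_generated_by
     {{x \<in> l2_space. l2_inner x y \<in> U} | y U. y \<in> l2_space \<and> open U}"

text \<open>Uniform Eberlein: homeomorphic to a (weakly) compact subset of a Hilbert space
  with its weak topology; the Hilbert space is taken to be l2 over the point type
  of the space (sufficient since w(K) <= |K| for compact K).\<close>
definition uniform_Eberlein :: "'a topology \<Rightarrow> bool" where
  "uniform_Eberlein K \<longleftrightarrow> compact_space K \<and>
     (\<exists>f :: 'a \<Rightarrow> ('a \<Rightarrow> real). embedding_map K l2_weak_topology f)"

text \<open>The class A (intrinsic form): X is in A if it is empty, a point, or an
  Aleksandrov compactification of an open subspace Y (|X - Y| <= 1, Y dense)
  which is the topological sum of a family of (open, pairwise disjoint)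
  subspaces each belonging to A.\<close>
inductive classA :: "'a topology \<Rightarrow> bool" where
  empty: "topspace X = {} \<Longrightarrow> classA X"
| point: "topspace X = {p} \<Longrightarrow> classA X"
| alex: "\<lbrakk> compact_space X; Hausdorff_space X;
           Y \<subseteq> topspace X; openin X Y; X closure_of Y = topspace X;
           finite (topspace X - Y); card (topspace X - Y) \<le> 1;
           \<Union>\<F> = Y; pairwise disjnt \<F>; \<And>U. U \<in> \<F> \<Longrightarrow> openin X U;
           \<And>U. U \<in> \<F> \<Longrightarrow> classA (subtopology X U) \<rbrakk> \<Longrightarrow> classA X"

end

theory Submission
  imports Defs
begin

text \<open>
  A member of the class \<open>\<A>\<close> is a well-founded tree of clopen sets: each node is the Aleksandrov
  compactification of the sum of its children, and every point is the point at infinity of exactly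
  one node. Weighting the indicator of the node of \<open>x\<close> by \<open>2\<close> to the power minus its depth
  gives a bounded injective map into \<open>\<ell>\<^sub>2\<close> with locally constant coordinates, hence a weak embedding.

  Conversely, let \<open>W\<close> be the union of the open sets all of whose clopen subsets are in \<open>\<A>\<close>. If
  \<open>W\<close> is not everything, its complement has an isolated point \<open>p\<close>; a clopen neighbourhood of \<open>p\<close>
  minus \<open>p\<close> is contained in \<open>W\<close>, and by paracompactness it splits into clopen pieces, so that
  neighbourhood is in \<open>\<A>\<close>, a contradiction.

  A scattered metrizable space is a countable union of uniformly separated sets, hence open covers
  have disjoint open refinements. The induction above, with a decreasing clopen base at \<open>p\<close>, then
  yields a well-founded tree of clopen sets generating the topology. The closure of the space in the
  Cantor cube over the nodes only adds the branches of the tree, and it belongs to \<open>\<A>\<close>.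
\<close>

section \<open>Spaces in the class \<open>\<A>\<close>\<close>

text \<open>In the converse direction, paracompactness is needed only for a compact clopen set with
  one point removed. It gives a locally finite open cover there, while the class asks for a
  partition into open pieces. Passing from one to the other is the main obstacle, and compact clopen
  sets overcome it because local finiteness becomes finiteness on them. The weights come from the
  fact that nodes of equal depth are disjoint: a point meets at most one node of each depth, so its
  coordinates sum to at most 1 + 1/2 + 1/4 + ... = 2. Together with local constancy of each
  coordinate, this uniform l1 bound yields weak continuity. A scattered metric space offers no
  compactness to extract finite subcovers. The substitute is right separation: each point has a ball
  that meets only the point itself and strictly earlier Cantor-Bendixson stages, so two points with
  large balls cannot be close together. Sorting points by the size of these balls gives the
  countably many uniformly separated sets.\<close>

abbreviation clopenin :: "'a topology \<Rightarrow> 'a set \<Rightarrow> bool" where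
  "clopenin X S \<equiv> openin X S \<and> closedin X S"

lemma clopenin_finite_Union:
  assumes "finite \<F>" "\<And>S. S \<in> \<F> \<Longrightarrow> clopenin X S"
  shows "clopenin X (\<Union>\<F>)"
  using assms by (auto intro!: openin_Union closedin_Union)

lemma clopenin_Diff: "clopenin X S \<Longrightarrow> clopenin X T \<Longrightarrow> clopenin X (S - T)"
  by (simp add: openin_diff closedin_diff)

lemma clopenin_Int: "clopenin X S \<Longrightarrow> clopenin X T \<Longrightarrow> clopenin X (S \<inter> T)"
  by (simp add: openin_Int closedin_Int)

lemma clopenin_trans:
  assumes "clopenin X U" "clopenin (subtopology X U) S"
  shows "clopenin X S"
  using assms by (meson openin_trans_full closedin_trans_full)

lemma clopenin_subtopology:
  "clopenin X S \<Longrightarrow> S \<subseteq> U \<Longrightarrow> clopenin (subtopology X U) S"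
  by (metis Int_absorb1 closedin_subtopology_Int_closed openin_subtopology_Int2)

lemma classA_imp_compact_space: "classA X \<Longrightarrow> compact_space X"
  by (induction rule: classA.induct)
    (auto simp: compact_space_def intro: finite_imp_compactin)

text \<open>The rule \<open>alex\<close> only asks the summands to be open. Members of the class are
  compact, so in a Hausdorff space the summands are closed too, and open sets stay open when
  finitely many summands are removed.\<close>

lemma compact_summand_clopenin:
  assumes "Hausdorff_space X" "openin X U" "compact_space (subtopology X U)"
  shows "clopenin X U"
  using assms by (metis compactin_imp_closedin compactin_subspace openin_subset)

lemma card_le_1_cases:
  assumes "finite A" "card A \<le> 1"
  obtains "A = {}" | p where "A = {p}"
  using assms by (metis card_0_eq card_1_singletonE le_neq_implies_less less_one)

text \<open>A set that meets some summand has an isolated point there by induction, and the point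
  stays isolated because the summand is open. A nonempty set that misses all summands is just the
  point at infinity.\<close>

lemma classA_imp_scattered: "classA X \<Longrightarrow> scattered_space X"
proof (induction rule: classA.induct)
  case (empty X)
  then show ?case by (auto simp: scattered_space_def)
next
  case (point X p)
  have "\<exists>x\<in>S. \<exists>U. openin X U \<and> U \<inter> S = {x}" if "S \<subseteq> {p}" "S \<noteq> {}" for S
    using that point openin_topspace[of X]
    by (intro bexI[of _ p] exI[of _ "topspace X"]) auto
  then show ?case by (simp add: scattered_space_def point)
next
  case (alex X Y \<F>)
  show ?case
    unfolding scattered_space_def
  proof (intro allI impI, elim conjE)
    fix S assume S: "S \<subseteq> topspace X" "S \<noteq> {}"
    show "\<exists>x\<in>S. \<exists>U. openin X U \<and> U \<inter> S = {x}"
    proof (cases "S \<inter> Y = {}")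
      case True
      then have "S \<subseteq> topspace X - Y" using S by auto
      with \<open>S \<noteq> {}\<close> alex(6,7) obtain p where "S = {p}"
        by (elim card_le_1_cases) (auto simp: subset_singleton_iff)
      then show ?thesis using S
        by (intro bexI[of _ p] exI[of _ "topspace X"]) auto
    next
      case False
      then obtain U where U: "U \<in> \<F>" "S \<inter> U \<noteq> {}"
        using alex by blast
      then have "openin X U" using alex by blast
      then have sub: "topspace (subtopology X U) = U"
        by (metis openin_subset topspace_subtopology_subset)
      then obtain x V where "x \<in> S \<inter> U" "openin (subtopology X U) V" "V \<inter> (S \<inter> U) = {x}"
        using alex.IH[OF U(1)] U(2) unfolding scattered_space_def
        by (metis Int_lower2)
      moreover from this have "V \<subseteq> U" "openin X V"
        using sub openin_subset \<open>openin X U\<close> openin_trans_full by blast+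
      ultimately show ?thesis
        by (intro bexI[of _ x] exI[of _ V]) auto
    qed
  qed
qed

text \<open>Since the refinement covers exactly the union of the given family rather than the whole space,
  this property passes to all subspaces.\<close>

definition disjoint_refinable :: "'a topology \<Rightarrow> bool" where
  "disjoint_refinable X \<longleftrightarrow>
     (\<forall>\<U>. (\<forall>U\<in>\<U>. openin X U) \<longrightarrow>
        (\<exists>\<V>. (\<forall>V\<in>\<V>. openin X V \<and> (\<exists>U\<in>\<U>. V \<subseteq> U)) \<and> \<Union>\<V> = \<Union>\<U> \<and> pairwise disjnt \<V>))"

lemma pairwise_disjnt_Union:
  assumes "pairwise disjnt \<G>" "\<And>G. G \<in> \<G> \<Longrightarrow> pairwise disjnt (R G)"
    and "\<And>G V. G \<in> \<G> \<Longrightarrow> V \<in> R G \<Longrightarrow> V \<subseteq> G"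
  shows "pairwise disjnt (\<Union>G\<in>\<G>. R G)"
proof (rule pairwiseI)
  fix V V' assume "V \<in> (\<Union>G\<in>\<G>. R G)" "V' \<in> (\<Union>G\<in>\<G>. R G)" "V \<noteq> V'"
  then obtain G G' where G: "G \<in> \<G>" "V \<in> R G" "G' \<in> \<G>" "V' \<in> R G'" by auto
  show "disjnt V V'"
  proof (cases "G = G'")
    case True
    then show ?thesis using G assms(2) \<open>V \<noteq> V'\<close> by (metis pairwiseD)
  next
    case False
    then show ?thesis using G assms(1,3) by (meson disjnt_subset1 disjnt_subset2 pairwiseD)
  qed
qed

text \<open>If no member of the family contains a point at infinity, the refinements inside the
  summands can simply be united. Otherwise some \<open>U0\<close> contains it, and the compact
  complement of \<open>U0\<close> is covered by finitely many summands. These are refined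
  separately, and the rest of \<open>U0\<close> is kept as a single piece.\<close>

lemma classA_imp_disjoint_refinable: "classA X \<Longrightarrow> disjoint_refinable X"
proof (induction rule: classA.induct)
  case (empty X)
  then show ?case unfolding disjoint_refinable_def
    by (intro allI impI exI[of _ "{}"]) (auto dest: openin_subset)
next
  case (point X p)
  have "\<exists>\<V>. (\<forall>V\<in>\<V>. openin X V \<and> (\<exists>U\<in>\<U>. V \<subseteq> U)) \<and> \<Union>\<V> = \<Union>\<U> \<and> pairwise disjnt \<V>"
    if \<U>: "\<forall>U\<in>\<U>. openin X U" for \<U>
  proof (intro exI[of _ "{V. V = {p} \<and> p \<in> \<Union>\<U>}"] conjI)
    have "U \<subseteq> {p}" if "U \<in> \<U>" for U using \<U> that point openin_subset by metis
    then show "\<Union>{V. V = {p} \<and> p \<in> \<Union>\<U>} = \<Union>\<U>" by auto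
    show "\<forall>V\<in>{V. V = {p} \<and> p \<in> \<Union>\<U>}. openin X V \<and> (\<exists>U\<in>\<U>. V \<subseteq> U)"
      using point openin_topspace[of X] by auto
    show "pairwise disjnt {V. V = {p} \<and> p \<in> \<Union>\<U>}" by (auto simp: pairwise_def)
  qed
  then show ?case by (simp add: disjoint_refinable_def)
next
  case (alex X Y \<F>)
  have clop: "clopenin X F" if "F \<in> \<F>" for F
    using that alex compact_summand_clopenin classA_imp_compact_space by metis
  show ?case
    unfolding disjoint_refinable_def
  proof (intro allI impI)
    fix \<U> assume \<U>: "\<forall>U\<in>\<U>. openin X U"
    have "\<forall>F\<in>\<F>. \<exists>\<V>. (\<forall>V\<in>\<V>. openin X V \<and> V \<subseteq> F \<and> (\<exists>U\<in>\<U>. V \<subseteq> U)) \<and>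
            \<Union>\<V> = \<Union>\<U> \<inter> F \<and> pairwise disjnt \<V>"
    proof
      fix F assume F: "F \<in> \<F>"
      have "\<forall>U\<in>(\<lambda>U. U \<inter> F) ` \<U>. openin (subtopology X F) U"
        using \<U> by (auto simp: openin_subtopology)
      then obtain \<V> where \<V>: "\<forall>V\<in>\<V>. openin (subtopology X F) V \<and> (\<exists>U\<in>(\<lambda>U. U \<inter> F) ` \<U>. V \<subseteq> U)"
        "\<Union>\<V> = \<Union>((\<lambda>U. U \<inter> F) ` \<U>)" "pairwise disjnt \<V>"
        using alex.IH[OF F] unfolding disjoint_refinable_def by meson
      then show "\<exists>\<V>. (\<forall>V\<in>\<V>. openin X V \<and> V \<subseteq> F \<and> (\<exists>U\<in>\<U>. V \<subseteq> U)) \<and>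
            \<Union>\<V> = \<Union>\<U> \<inter> F \<and> pairwise disjnt \<V>"
      proof (intro exI[of _ \<V>] conjI ballI)
        fix V assume "V \<in> \<V>"
        then obtain U where "U \<in> \<U>" "V \<subseteq> U \<inter> F" "openin (subtopology X F) V"
          using \<V>(1) by auto
        then show "openin X V" "V \<subseteq> F" "\<exists>U\<in>\<U>. V \<subseteq> U"
          using clop[OF F] openin_trans_full by blast+
      qed auto
    qed
    then obtain R where R: "\<And>F. F \<in> \<F> \<Longrightarrow> (\<forall>V\<in>R F. openin X V \<and> V \<subseteq> F \<and> (\<exists>U\<in>\<U>. V \<subseteq> U)) \<and>
            \<Union>(R F) = \<Union>\<U> \<inter> F \<and> pairwise disjnt (R F)"
      by metis
    show "\<exists>\<V>. (\<forall>V\<in>\<V>. openin X V \<and> (\<exists>U\<in>\<U>. V \<subseteq> U)) \<and> \<Union>\<V> = \<Union>\<U> \<and> pairwise disjnt \<V>"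
    proof (cases "\<Union>\<U> \<subseteq> Y")
      case True
      have "pairwise disjnt (\<Union>F\<in>\<F>. R F)"
        using R by (intro pairwise_disjnt_Union[OF \<open>pairwise disjnt \<F>\<close>]) simp_all
      moreover have "\<Union>(\<Union>F\<in>\<F>. R F) = \<Union>\<U>"
      proof -
        have "\<Union>(\<Union>F\<in>\<F>. R F) = (\<Union>F\<in>\<F>. \<Union>(R F))" by blast
        also have "\<dots> = (\<Union>F\<in>\<F>. \<Union>\<U> \<inter> F)"
          by (rule SUP_cong) (use R in simp_all)
        also have "\<dots> = \<Union>\<U>" using True alex by blast
        finally show ?thesis .
      qed
      ultimately show ?thesis using R by (intro exI[of _ "\<Union>F\<in>\<F>. R F"]) simp
    next
      case False
      then obtain p U0 where p: "p \<in> U0" "U0 \<in> \<U>" "p \<notin> Y" by blast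
      then have "p \<in> topspace X" using \<U> openin_subset by blast
      with p have "p \<in> topspace X - Y" by simp
      with alex(6,7) have Yp: "topspace X - Y = {p}"
        by (metis card_le_1_cases empty_iff singletonD)
      have "compactin X (topspace X - U0)"
        using \<U> p \<open>compact_space X\<close> closedin_compact_space by blast
      moreover have "topspace X - U0 \<subseteq> \<Union>\<F>"
      proof
        fix x assume "x \<in> topspace X - U0"
        then have "x \<notin> topspace X - Y" using p unfolding Yp by blast
        then show "x \<in> \<Union>\<F>" using \<open>x \<in> topspace X - U0\<close> \<open>\<Union>\<F> = Y\<close> by simp
      qed
      ultimately obtain \<G> where \<G>: "finite \<G>" "\<G> \<subseteq> \<F>" "topspace X - U0 \<subseteq> \<Union>\<G>"
        using alex unfolding compactin_def by metis
      define V0 where "V0 = U0 - \<Union>\<G>"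
      have "openin X V0"
        unfolding V0_def using clopenin_finite_Union[OF \<G>(1), of X] clop \<G> \<U> p
        by (meson openin_diff subsetD)
      moreover have "pairwise disjnt (insert V0 (\<Union>F\<in>\<G>. R F))"
      proof (rule pairwise_insert[THEN iffD2], intro conjI allI impI)
        show "pairwise disjnt (\<Union>F\<in>\<G>. R F)"
          using R \<G>(2) by (intro pairwise_disjnt_Union[OF pairwise_subset[OF \<open>pairwise disjnt \<F>\<close>]])
            (simp_all add: subset_iff)
        fix V assume "V \<in> (\<Union>F\<in>\<G>. R F) \<and> V \<noteq> V0"
        then have "V \<subseteq> \<Union>\<G>" using R \<G> by blast
        then show "disjnt V0 V" "disjnt V V0" by (auto simp: V0_def disjnt_iff)
      qed
      moreover have "\<Union>(insert V0 (\<Union>F\<in>\<G>. R F)) = \<Union>\<U>"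
      proof -
        have "\<Union>(insert V0 (\<Union>F\<in>\<G>. R F)) = V0 \<union> (\<Union>F\<in>\<G>. \<Union>(R F))" by blast
        also have "(\<Union>F\<in>\<G>. \<Union>(R F)) = (\<Union>F\<in>\<G>. \<Union>\<U> \<inter> F)"
          by (rule SUP_cong) (use R \<G>(2) in \<open>simp_all add: subset_iff\<close>)
        also have "V0 \<union> (\<Union>F\<in>\<G>. \<Union>\<U> \<inter> F) = \<Union>\<U>"
        proof
          show "V0 \<union> (\<Union>F\<in>\<G>. \<Union>\<U> \<inter> F) \<subseteq> \<Union>\<U>" using p by (auto simp: V0_def)
          have "\<Union>\<U> \<subseteq> topspace X" using \<U> openin_subset by blast
          then show "\<Union>\<U> \<subseteq> V0 \<union> (\<Union>F\<in>\<G>. \<Union>\<U> \<inter> F)" using \<G>(3) unfolding V0_def by blast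
        qed
        finally show ?thesis .
      qed
      moreover have "\<exists>U\<in>\<U>. V0 \<subseteq> U" using p by (auto simp: V0_def)
      moreover have "\<forall>V\<in>(\<Union>F\<in>\<G>. R F). openin X V \<and> (\<exists>U\<in>\<U>. V \<subseteq> U)"
      proof
        fix V assume "V \<in> (\<Union>F\<in>\<G>. R F)"
        then obtain F where "F \<in> \<F>" "V \<in> R F" using \<G>(2) by blast
        then show "openin X V \<and> (\<exists>U\<in>\<U>. V \<subseteq> U)" using R by simp
      qed
      ultimately show ?thesis
        by (intro exI[of _ "insert V0 (\<Union>F\<in>\<G>. R F)"]) simp
    qed
  qed
qed

lemma disjoint_open_imp_locally_finite_in:
  assumes "\<And>V. V \<in> \<V> \<Longrightarrow> openin X V" "\<Union>\<V> = topspace X" "pairwise disjnt \<V>"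
  shows "locally_finite_in X \<V>"
  unfolding locally_finite_in_def
proof (intro conjI ballI)
  show "\<Union>\<V> \<subseteq> topspace X" using assms by simp
  fix x assume "x \<in> topspace X"
  then obtain V where V: "V \<in> \<V>" "x \<in> V" using assms by blast
  have "{U \<in> \<V>. U \<inter> V \<noteq> {}} \<subseteq> {V}"
    using assms(3) V(1) by (auto simp: pairwise_def disjnt_def)
  then show "\<exists>V. openin X V \<and> x \<in> V \<and> finite {U \<in> \<V>. U \<inter> V \<noteq> {}}"
    using V assms by (meson finite.emptyI finite_insert finite_subset)
qed

text \<open>A relatively open cover of \<open>S\<close> extends to open sets of \<open>X\<close>.
  The trace on \<open>S\<close> of a disjoint refinement is a partition into relatively open sets,
  and such a partition is locally finite.\<close>

lemma disjoint_refinable_imp_hereditarily_paracompact: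
  assumes "Hausdorff_space X" "disjoint_refinable X"
  shows "hereditarily_paracompact X"
  unfolding hereditarily_paracompact_def paracompact_space_def
proof (intro allI impI conjI, goal_cases)
  case (1 S)
  then show ?case using assms by (simp add: Hausdorff_space_subtopology)
next
  case (2 S \<U>)
  define \<U>' where "\<U>' = {U. openin X U \<and> S \<inter> U \<in> \<U>}"
  have "\<exists>V. openin X V \<and> U = S \<inter> V" if "U \<in> \<U>" for U
    using 2 that by (auto simp: openin_subtopology)
  then have \<U>': "\<And>U. U \<in> \<U>' \<Longrightarrow> openin X U" "\<U> = (\<lambda>U. S \<inter> U) ` \<U>'"
    unfolding \<U>'_def by (blast, blast)
  then obtain \<V> where \<V>: "\<And>V. V \<in> \<V> \<Longrightarrow> openin X V \<and> (\<exists>U\<in>\<U>'. V \<subseteq> U)"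
     "\<Union>\<V> = \<Union>\<U>'" "pairwise disjnt \<V>"
    using assms(2) unfolding disjoint_refinable_def by meson
  let ?W = "(\<lambda>V. S \<inter> V) ` \<V>"
  have W: "\<And>V. V \<in> ?W \<Longrightarrow> openin (subtopology X S) V"
    using \<V>(1) openin_subtopology_Int2 by blast
  have "\<Union>?W = S \<inter> \<Union>\<V>" by blast
  also have "\<dots> = \<Union>\<U>" unfolding \<V>(2) \<U>'(2) by blast
  finally have cov: "\<Union>?W = topspace (subtopology X S)" using 2 by simp
  have dis: "pairwise disjnt ?W"
    using \<V>(3) by (auto simp: pairwise_def disjnt_iff)
  have "\<forall>V\<in>?W. \<exists>U\<in>\<U>. V \<subseteq> U"
  proof
    fix V assume "V \<in> ?W"
    then obtain V' where "V' \<in> \<V>" "V = S \<inter> V'" by blast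
    moreover from this obtain U where "U \<in> \<U>'" "V' \<subseteq> U" using \<V>(1) by meson
    ultimately have "V \<subseteq> S \<inter> U" "S \<inter> U \<in> \<U>" by (auto simp: \<U>'_def)
    then show "\<exists>U\<in>\<U>. V \<subseteq> U" by meson
  qed
  then show ?case
    using W cov disjoint_open_imp_locally_finite_in[OF W cov dis]
    by (intro exI[of _ ?W]) simp
qed

lemma classA_imp_hereditarily_paracompact:
  "Hausdorff_space X \<Longrightarrow> classA X \<Longrightarrow> hereditarily_paracompact X"
  by (simp add: classA_imp_disjoint_refinable disjoint_refinable_imp_hereditarily_paracompact)

section \<open>Scattered hereditarily paracompact compacta\<close>

definition zero_dimensional :: "'a topology \<Rightarrow> bool" where
  "zero_dimensional X \<longleftrightarrow>
     (\<forall>U x. openin X U \<and> x \<in> U \<longrightarrow> (\<exists>C. clopenin X C \<and> x \<in> C \<and> C \<subseteq> U))"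

lemma zero_dimensionalE:
  assumes "zero_dimensional X" "openin X U" "x \<in> U"
  obtains C where "clopenin X C" "x \<in> C" "C \<subseteq> U"
  using assms unfolding zero_dimensional_def by meson

lemma zero_dimensional_compact_clopen:
  assumes "zero_dimensional X" "compactin X A" "openin X U" "A \<subseteq> U"
  obtains C where "clopenin X C" "A \<subseteq> C" "C \<subseteq> U"
proof -
  define \<C> where "\<C> = {C. clopenin X C \<and> C \<subseteq> U}"
  have "A \<subseteq> \<Union>\<C>"
    using assms unfolding zero_dimensional_def \<C>_def by blast
  moreover have "\<forall>C\<in>\<C>. openin X C" by (simp add: \<C>_def)
  ultimately obtain \<F> where \<F>: "finite \<F>" "\<F> \<subseteq> \<C>" "A \<subseteq> \<Union>\<F>"
    using assms(2) unfolding compactin_def by meson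
  show ?thesis
  proof (rule that)
    show "clopenin X (\<Union>\<F>)" using \<F> by (intro clopenin_finite_Union) (auto simp: \<C>_def)
  qed (use \<F> in \<open>auto simp: \<C>_def\<close>)
qed

text \<open>An isolated point of a connected component is clopen in that component, so every
  component is a single point. In a compact Hausdorff space components are quasi-components, hence
  clopen sets separate points, and compactness of the complement of \<open>U\<close> reduces to
  finitely many of them.\<close>

lemma compact_scattered_imp_zero_dimensional:
  assumes "compact_space X" "Hausdorff_space X" "scattered_space X"
  shows "zero_dimensional X"
  unfolding zero_dimensional_def
proof (intro allI impI, elim conjE)
  fix U x assume U: "openin X U" "x \<in> U"
  then have x: "x \<in> topspace X" using openin_subset by blast
  have single: "connected_component_of_set X x = {x}"
  proof -
    let ?C = "connected_component_of_set X x"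
    have xC: "x \<in> ?C" using x connected_component_of_refl by fastforce
    have sub: "?C \<subseteq> topspace X" by (rule connected_component_of_subset_topspace)
    obtain y V where y: "y \<in> ?C" "openin X V" "V \<inter> ?C = {y}"
      using assms(3) xC sub unfolding scattered_space_def by (metis empty_iff)
    have "connectedin X ?C" by (rule connectedin_connected_component_of)
    moreover have "openin (subtopology X ?C) {y}"
      using y by (metis inf_commute openin_subtopology_Int2)
    moreover have "closedin (subtopology X ?C) {y}"
      using y sub assms(2) Hausdorff_space_subtopology Hausdorff_imp_t1_space
      by (metis closedin_Hausdorff_singleton topspace_subtopology_subset)
    ultimately have "{y} = ?C"
      using sub unfolding connectedin_def connected_space_clopen_in
      by (metis insert_not_empty topspace_subtopology_subset)
    then show ?thesis using xC by (metis singletonD)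
  qed
  have "quasi_component_of X x = connected_component_of X x"
    using assms by (intro quasi_eq_connected_component_of) auto
  then have sep: "\<exists>C. clopenin X C \<and> x \<in> C \<and> y \<notin> C" if "y \<in> topspace X - U" for y
  proof -
    have "y \<noteq> x" using that U by blast
    then have "\<not> connected_component_of X x y" using single by (metis mem_Collect_eq singletonD)
    then have "\<not> quasi_component_of X x y" using \<open>quasi_component_of X x = connected_component_of X x\<close> by simp
    then show ?thesis using that x unfolding quasi_component_of by blast
  qed
  define \<C> where "\<C> = {topspace X - C |C. clopenin X C \<and> x \<in> C}"
  have "topspace X - U \<subseteq> \<Union>\<C>"
  proof
    fix y assume y: "y \<in> topspace X - U"
    then obtain C where "clopenin X C" "x \<in> C" "y \<notin> C" using sep by blast
    then show "y \<in> \<Union>\<C>" using y unfolding \<C>_def by blast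
  qed
  moreover have "compactin X (topspace X - U)"
    using assms(1) U(1) by (meson closedin_compact_space closedin_diff closedin_topspace)
  moreover have "\<forall>C\<in>\<C>. openin X C" by (auto simp: \<C>_def)
  ultimately obtain \<F> where \<F>: "finite \<F>" "\<F> \<subseteq> \<C>" "topspace X - U \<subseteq> \<Union>\<F>"
    unfolding compactin_def by meson
  have "clopenin X (\<Union>\<F>)"
    using \<F> by (intro clopenin_finite_Union) (auto simp: \<C>_def)
  then have "clopenin X (topspace X - \<Union>\<F>)" by (meson clopenin_Diff openin_topspace closedin_topspace)
  moreover have "x \<in> topspace X - \<Union>\<F>" using x \<F>(2) by (auto simp: \<C>_def)
  ultimately show "\<exists>C. clopenin X C \<and> x \<in> C \<and> C \<subseteq> U" using \<F>(3) by blast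
qed

text \<open>The partition consists of the classes of points that lie in the same members of \<open>\<C>\<close>, so no
  well-ordering of \<open>\<C>\<close> is needed.\<close>

lemma clopen_atoms:
  assumes "\<And>C. C \<in> \<C> \<Longrightarrow> clopenin X C"
    and fin: "\<And>C. C \<in> \<C> \<Longrightarrow> finite {C' \<in> \<C>. C \<inter> C' \<noteq> {}}"
  shows "\<exists>\<D>. pairwise disjnt \<D> \<and> \<Union>\<D> = \<Union>\<C> \<and>
    (\<forall>D\<in>\<D>. clopenin X D) \<and> (\<forall>D\<in>\<D>. \<exists>C\<in>\<C>. D \<subseteq> C)"
proof -
  define atom where "atom x = {y. \<forall>C\<in>\<C>. x \<in> C \<longleftrightarrow> y \<in> C}" for x
  have clop: "clopenin X (atom x)" if x: "x \<in> C0" "C0 \<in> \<C>" for x C0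
  proof -
    define \<F> where "\<F> = {C \<in> \<C>. C0 \<inter> C \<noteq> {}}"
    \<comment> \<open>Inside \<open>C0\<close> only the finitely many members meeting
      \<open>C0\<close> matter: those that miss \<open>x\<close> are removed entirely, and for those
      that contain \<open>x\<close> the part of \<open>C0\<close> outside them is removed.\<close>
    define \<G> where "\<G> = {C \<in> \<F>. x \<notin> C} \<union> (\<lambda>C. C0 - C) ` {C \<in> \<F>. x \<in> C}"
    have "y \<in> atom x \<longleftrightarrow> y \<in> C0 - \<Union>\<G>" for y
      using x unfolding atom_def \<G>_def \<F>_def by auto
    then have "atom x = C0 - \<Union>\<G>" by blast
    moreover have "clopenin X (\<Union>\<G>)"
    proof (rule clopenin_finite_Union)
      have "finite \<F>" using fin[OF x(2)] by (simp add: \<F>_def)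
      then show "finite \<G>" by (simp add: \<G>_def)
      show "clopenin X S" if "S \<in> \<G>" for S
        using that assms(1) assms(1)[OF x(2)] by (auto simp: \<G>_def \<F>_def openin_diff closedin_diff)
    qed
    ultimately show ?thesis using assms(1)[OF x(2)] by (metis clopenin_Diff)
  qed
  show ?thesis
  proof (intro exI[of _ "atom ` \<Union>\<C>"] conjI)
    show "pairwise disjnt (atom ` \<Union>\<C>)"
      by (auto simp: pairwise_def disjnt_iff atom_def)
    show "\<Union>(atom ` \<Union>\<C>) = \<Union>\<C>" by (auto simp: atom_def)
    show "\<forall>D\<in>atom ` \<Union>\<C>. clopenin X D" using clop by blast
    show "\<forall>D\<in>atom ` \<Union>\<C>. \<exists>C\<in>\<C>. D \<subseteq> C" unfolding atom_def by blast
  qed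
qed

lemma locally_finite_in_compact:
  assumes "locally_finite_in X \<V>" "compactin X S"
  shows "finite {V \<in> \<V>. V \<inter> S \<noteq> {}}"
proof -
  define \<U> where "\<U> = {U. openin X U \<and> finite {V \<in> \<V>. V \<inter> U \<noteq> {}}}"
  have "S \<subseteq> \<Union>\<U>"
    using assms compactin_subset_topspace[OF assms(2)] unfolding locally_finite_in_def \<U>_def by blast
  moreover have "\<forall>U\<in>\<U>. openin X U" by (simp add: \<U>_def)
  ultimately obtain \<F> where \<F>: "finite \<F>" "\<F> \<subseteq> \<U>" "S \<subseteq> \<Union>\<F>"
    using assms(2) unfolding compactin_def by meson
  have "{V \<in> \<V>. V \<inter> S \<noteq> {}} \<subseteq> (\<Union>U\<in>\<F>. {V \<in> \<V>. V \<inter> U \<noteq> {}})" using \<F>(3) by blast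
  moreover have "finite \<dots>" using \<F> by (auto simp: \<U>_def)
  ultimately show ?thesis by (rule finite_subset)
qed

text \<open>To apply \<open>clopen_atoms\<close>, clopen sets are needed each of which meets only
  finitely many others. Every member \<open>V\<close> of a locally finite refinement is therefore
  thickened to a clopen \<open>C V\<close> that contains its closure and stays inside a compact
  clopen \<open>K V\<close>.\<close>

lemma paracompact_open_clopen_partition:
  assumes X: "compact_space X" "Hausdorff_space X" "zero_dimensional X"
    and Y: "openin X Y" "paracompact_space (subtopology X Y)"
  obtains \<D> where "pairwise disjnt \<D>" "\<Union>\<D> = Y" "\<And>D. D \<in> \<D> \<Longrightarrow> clopenin X D"
proof -
  define \<O> where "\<O> = {C. clopenin X C \<and> C \<subseteq> Y}"
  have top: "topspace (subtopology X Y) = Y"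
    using Y by (metis openin_subset topspace_subtopology_subset)
  have "\<forall>U\<in>\<O>. openin (subtopology X Y) U"
    using clopenin_subtopology by (auto simp: \<O>_def)
  moreover have "\<Union>\<O> = topspace (subtopology X Y)"
    using X(3) Y(1) unfolding zero_dimensional_def \<O>_def top by blast
  ultimately have "\<exists>\<V>. (\<forall>V\<in>\<V>. openin (subtopology X Y) V) \<and> \<Union>\<V> = topspace (subtopology X Y) \<and>
        (\<forall>V\<in>\<V>. \<exists>U\<in>\<O>. V \<subseteq> U) \<and> locally_finite_in (subtopology X Y) \<V>"
    using Y(2) unfolding paracompact_space_def by simp
  then obtain \<V> where \<V>: "\<forall>V\<in>\<V>. openin (subtopology X Y) V" "\<Union>\<V> = Y"
    "\<forall>V\<in>\<V>. \<exists>U\<in>\<O>. V \<subseteq> U" "locally_finite_in (subtopology X Y) \<V>"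
    unfolding top by (elim exE conjE) (rule that)
  obtain K where K: "\<And>V. V \<in> \<V> \<Longrightarrow> K V \<in> \<O>" "\<And>V. V \<in> \<V> \<Longrightarrow> V \<subseteq> K V"
    using \<V>(3) by metis
  have VX: "V \<subseteq> topspace X" if "V \<in> \<V>" for V
    using that \<V>(2) Y(1) openin_subset by blast
  define meets where "meets V = {W \<in> \<V>. W \<inter> K V \<noteq> {}}" for V
  have fin: "finite (meets V)" if "V \<in> \<V>" for V
  proof -
    have "compactin X (K V)"
      using K(1)[OF that] X(1) by (simp add: \<O>_def closedin_compact_space)
    then have "compactin (subtopology X Y) (K V)"
      using K(1)[OF that] by (simp add: \<O>_def compactin_subtopology)
    then show ?thesis
      unfolding meets_def using locally_finite_in_compact[OF \<V>(4)] by blast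
  qed
  have cl_K: "X closure_of V \<subseteq> K V" if "V \<in> \<V>" for V
    using K[OF that] by (simp add: \<O>_def closure_of_minimal)
  \<comment> \<open>Shrinking \<open>K V\<close> away from the sets whose closure misses that of \<open>V\<close> makes the family of the
    sets \<open>C V\<close> below locally finite; the sets \<open>K V\<close> themselves need not be.\<close>
  define E where "E V = K V - \<Union>((closure_of) X ` {W \<in> meets V. X closure_of W \<inter> X closure_of V = {}})" for V
  have "\<exists>C. clopenin X C \<and> X closure_of V \<subseteq> C \<and> C \<subseteq> E V" if "V \<in> \<V>" for V
  proof -
    have "openin X (E V)"
      unfolding E_def using K(1)[OF that] fin[OF that]
      by (intro openin_diff closedin_Union) (auto simp: \<O>_def)
    moreover have "X closure_of V \<subseteq> E V"
      unfolding E_def using cl_K[OF that] by blast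
    moreover have "compactin X (X closure_of V)"
      using X(1) by (simp add: closedin_compact_space)
    ultimately show ?thesis using zero_dimensional_compact_clopen[OF X(3)] by metis
  qed
  then obtain C where C: "\<And>V. V \<in> \<V> \<Longrightarrow> clopenin X (C V)"
    "\<And>V. V \<in> \<V> \<Longrightarrow> X closure_of V \<subseteq> C V" "\<And>V. V \<in> \<V> \<Longrightarrow> C V \<subseteq> E V" by metis
  have VC: "V \<subseteq> C V" if "V \<in> \<V>" for V
    using closure_of_subset[OF VX[OF that]] C(2)[OF that] by blast
  \<comment> \<open>If \<open>C V\<close> meets \<open>W\<close>, then by the choice of
    \<open>E V\<close> the closures of \<open>V\<close> and \<open>W\<close> meet. The closure of
    \<open>W\<close> lies in the open set \<open>K W\<close>, so \<open>V\<close> itself meets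
    \<open>K W\<close>, which happens for finitely many \<open>V\<close> only.\<close>
  have fin2: "{V \<in> \<V>. C V \<inter> W \<noteq> {}} \<subseteq> meets W" if W: "W \<in> \<V>" for W
  proof
    fix V assume "V \<in> {V \<in> \<V>. C V \<inter> W \<noteq> {}}"
    then obtain x where V: "V \<in> \<V>" "x \<in> C V" "x \<in> W" by blast
    have xW: "x \<in> X closure_of W" using closure_of_subset[OF VX[OF W]] V(3) by blast
    have "x \<in> E V" using V C(3) by blast
    then have "W \<in> meets V" using W V(3) by (auto simp: meets_def E_def)
    then have "X closure_of W \<inter> X closure_of V \<noteq> {}"
      using xW \<open>x \<in> E V\<close> unfolding E_def by blast
    then obtain z where z: "z \<in> K W" "z \<in> X closure_of V" using cl_K[OF W] by blast
    moreover have "openin X (K W)" using K(1)[OF W] by (simp add: \<O>_def)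
    ultimately have "V \<inter> K W \<noteq> {}" unfolding in_closure_of by blast
    then show "V \<in> meets W" using V(1) by (simp add: meets_def)
  qed
  \<comment> \<open>A common point of \<open>C V\<close> and \<open>C V'\<close> lies in some
    \<open>W\<close> of the cover. There are finitely many such \<open>W\<close>, because they meet
    \<open>K V\<close>, and for each of them finitely many \<open>V'\<close> by
    \<open>fin2\<close>.\<close>
  have fin3: "finite {C' \<in> C ` \<V>. C V \<inter> C' \<noteq> {}}" if V: "V \<in> \<V>" for V
  proof -
    have "{C' \<in> C ` \<V>. C V \<inter> C' \<noteq> {}} \<subseteq> C ` (\<Union>W\<in>meets V. meets W)"
    proof
      fix C' assume "C' \<in> {C' \<in> C ` \<V>. C V \<inter> C' \<noteq> {}}"
      then obtain x V' where V': "V' \<in> \<V>" "x \<in> C V" "x \<in> C V'" and "C' = C V'" by blast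
      have "x \<in> K V" using C(3)[OF V] V' by (auto simp: E_def)
      moreover have "K V \<subseteq> Y" using K(1)[OF V] by (simp add: \<O>_def)
      ultimately obtain W where W: "W \<in> \<V>" "x \<in> W" using \<V>(2) by blast
      then have "W \<in> meets V" using \<open>x \<in> K V\<close> by (auto simp: meets_def)
      moreover have "V' \<in> meets W" using fin2[OF W(1)] V' W by blast
      ultimately show "C' \<in> C ` (\<Union>W\<in>meets V. meets W)" using \<open>C' = C V'\<close> by blast
    qed
    moreover have "finite (\<Union>W\<in>meets V. meets W)"
      using fin V by (auto simp: meets_def)
    ultimately show ?thesis by (meson finite_imageI finite_subset)
  qed
  have "\<Union>(C ` \<V>) = Y"
  proof
    have "C V \<subseteq> Y" if "V \<in> \<V>" for V
      using C(3)[OF that] K(1)[OF that] by (auto simp: E_def \<O>_def)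
    then show "\<Union>(C ` \<V>) \<subseteq> Y" by blast
    show "Y \<subseteq> \<Union>(C ` \<V>)" using \<V>(2) VC by blast
  qed
  moreover have "\<exists>\<D>. pairwise disjnt \<D> \<and> \<Union>\<D> = \<Union>(C ` \<V>) \<and>
    (\<forall>D\<in>\<D>. clopenin X D) \<and> (\<forall>D\<in>\<D>. \<exists>C'\<in>C ` \<V>. D \<subseteq> C')"
    by (rule clopen_atoms) (use C(1) fin3 in auto)
  ultimately show ?thesis using that by auto
qed

text \<open>This is used with membership in the class and with the existence of a node tree. In
  \<open>glue\<close> the property is available for all clopen subsets of the members of
  \<open>\<U>\<close>, so that the pieces of an arbitrary clopen refinement inherit it.\<close>

lemma scattered_clopen_induct:
  assumes "scattered_space X" "zero_dimensional X"
    and glue: "\<And>V \<U>. \<lbrakk>clopenin X V; V \<subseteq> \<Union>\<U>; \<And>U. U \<in> \<U> \<Longrightarrow> openin X U;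
       \<And>U C. \<lbrakk>U \<in> \<U>; clopenin X C; C \<subseteq> U\<rbrakk> \<Longrightarrow> P C\<rbrakk> \<Longrightarrow> P V"
    and point: "\<And>V p. \<lbrakk>clopenin X V; p \<in> V; \<And>C. \<lbrakk>clopenin X C; C \<subseteq> V - {p}\<rbrakk> \<Longrightarrow> P C\<rbrakk> \<Longrightarrow> P V"
  shows "P (topspace X)"
proof -
  define \<U> where "\<U> = {U. openin X U \<and> (\<forall>C. clopenin X C \<and> C \<subseteq> U \<longrightarrow> P C)}"
  have small: "P V" if "clopenin X V" "V \<subseteq> \<Union>\<U>" for V
  proof (rule glue[OF that])
    show "openin X U" if "U \<in> \<U>" for U using that by (simp add: \<U>_def)
    show "P C" if "U \<in> \<U>" "clopenin X C" "C \<subseteq> U" for U C using that by (simp add: \<U>_def)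
  qed
  have "topspace X \<subseteq> \<Union>\<U>"
  proof (rule ccontr)
    assume "\<not> topspace X \<subseteq> \<Union>\<U>"
    then obtain p G where p: "p \<in> topspace X - \<Union>\<U>" "openin X G" "G \<inter> (topspace X - \<Union>\<U>) = {p}"
      using assms(1) unfolding scattered_space_def by (metis Diff_eq_empty_iff Diff_subset)
    then have "p \<in> G" by blast
    then obtain C where C: "clopenin X C" "p \<in> C" "C \<subseteq> G"
      by (rule zero_dimensionalE[OF assms(2) p(2)])
    have rest: "C - {p} \<subseteq> \<Union>\<U>" using C p openin_subset[OF p(2)] by blast
    \<comment> \<open>This must hold for all clopen parts of \<open>C\<close>, not only for
      \<open>C\<close>, in order that \<open>C\<close> qualifies as a member of
      \<open>\<U>\<close>.\<close>
    have "P D" if D: "clopenin X D" "D \<subseteq> C" for D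
    proof (cases "p \<in> D")
      case True
      show ?thesis
        by (rule point[OF D(1) True]) (use D rest in \<open>blast intro: small\<close>)
    next
      case False
      then show ?thesis using D rest by (intro small) auto
    qed
    then have "C \<in> \<U>" using C by (simp add: \<U>_def)
    then show False using C p by blast
  qed
  then show ?thesis by (intro small) auto
qed

section \<open>Assembling members of the class from clopen pieces\<close>

lemma classA_clopen_Union:
  assumes "compact_space X" "Hausdorff_space X" "clopenin X V" "\<Union>\<D> = V" "pairwise disjnt \<D>"
    and D: "\<And>D. D \<in> \<D> \<Longrightarrow> openin X D \<and> classA (subtopology X D)"
  shows "classA (subtopology X V)"
proof -
  have VX: "V \<subseteq> topspace X" using assms(3) openin_subset by blast
  then have top: "topspace (subtopology X V) = V" by (rule topspace_subtopology_subset)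
  have sub: "D \<subseteq> V" if "D \<in> \<D>" for D using that assms(4) by blast
  show ?thesis
  \<comment> \<open>The sum is already compact, so this is the Aleksandrov compactification that
    adds no point.\<close>
  proof (rule classA.alex[where Y = V and \<F> = \<D>])
    show "compact_space (subtopology X V)"
      using assms by (simp add: closedin_compact_space compact_space_subtopology)
    show "Hausdorff_space (subtopology X V)" using assms(2) by (rule Hausdorff_space_subtopology)
    show "subtopology X V closure_of V = topspace (subtopology X V)"
      using top by (metis closure_of_topspace)
    show "openin (subtopology X V) D" if "D \<in> \<D>" for D
      using D[OF that] sub[OF that] by (metis inf.absorb2 openin_subtopology_Int2)
    show "classA (subtopology (subtopology X V) D)" if "D \<in> \<D>" for D
      using D[OF that] sub[OF that] by (simp add: subtopology_subtopology inf.absorb2)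
    show "openin (subtopology X V) V" using openin_topspace[of "subtopology X V"] top by simp
  qed (use assms(4,5) in \<open>simp_all only: top Diff_cancel finite.emptyI card.empty order.refl zero_le\<close>)
qed

text \<open>The rule \<open>alex\<close> requires the sum to be dense, which fails when
  \<open>p\<close> is isolated. In that case \<open>{p}\<close> is taken as one more summand;
  otherwise \<open>p\<close> is the point at infinity.\<close>

lemma classA_clopen_insert_point:
  assumes X: "compact_space X" "Hausdorff_space X" and V: "clopenin X V" "p \<in> V"
    and \<D>: "\<Union>\<D> = V - {p}" "pairwise disjnt \<D>"
    and D: "\<And>D. D \<in> \<D> \<Longrightarrow> openin X D \<and> classA (subtopology X D)"
  shows "classA (subtopology X V)"
proof (cases "openin X {p}")
  case True
  have "V \<subseteq> topspace X" using V(1) openin_subset by blast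
  then have "classA (subtopology X {p})"
    using V(2) by (intro classA.point[of _ p]) auto
  then show ?thesis
    using True D \<D> V
    by (intro classA_clopen_Union[OF X V(1), of "insert {p} \<D>"])
      (auto simp: pairwise_insert disjnt_iff)
next
  case False
  have top: "topspace (subtopology X V) = V"
    using V(1) by (metis openin_subset topspace_subtopology_subset)
  have sub: "D \<subseteq> V" if "D \<in> \<D>" for D using that \<D>(1) by blast
  have t1: "openin (subtopology X V) (V - {p})"
    using \<D>(1) D by (metis Int_Diff inf.idem openin_Union openin_subtopology_Int2 inf_commute Diff_Int_distrib)
  show ?thesis
  proof (rule classA.alex[where Y = "V - {p}" and \<F> = \<D>])
    show "compact_space (subtopology X V)"
      using X V by (simp add: closedin_compact_space compact_space_subtopology)
    show "Hausdorff_space (subtopology X V)" using X(2) by (rule Hausdorff_space_subtopology)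
    show "subtopology X V closure_of (V - {p}) = topspace (subtopology X V)"
    proof -
      have "p \<in> subtopology X V closure_of (V - {p})"
      proof (rule ccontr)
        assume "\<not> ?thesis"
        then obtain T where T: "openin (subtopology X V) T" "p \<in> T" "T \<inter> (V - {p}) = {}"
          using V(2) top unfolding in_closure_of by blast
        then have "T = {p}" using openin_subset[OF T(1)] top by blast
        then show False using False T(1) V(1) openin_trans_full by metis
      qed
      moreover have "V - {p} \<subseteq> subtopology X V closure_of (V - {p})"
        using top by (intro closure_of_subset) auto
      moreover have "subtopology X V closure_of (V - {p}) \<subseteq> V"
        using closure_of_subset_topspace top by metis
      ultimately show ?thesis using top by auto
    qed
    show "openin (subtopology X V) D" if "D \<in> \<D>" for D
      using D[OF that] sub[OF that] by (metis inf.absorb2 openin_subtopology_Int2)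
    show "classA (subtopology (subtopology X V) D)" if "D \<in> \<D>" for D
      using D[OF that] sub[OF that] by (simp add: subtopology_subtopology inf.absorb2)
    have "topspace (subtopology X V) - (V - {p}) = {p}" using V(2) top by auto
    then show "finite (topspace (subtopology X V) - (V - {p}))"
      "card (topspace (subtopology X V) - (V - {p})) \<le> 1" by simp_all
  qed (use top t1 \<D> in auto)
qed

lemma scattered_hereditarily_paracompact_imp_classA:
  assumes X: "compact_space X" "Hausdorff_space X" "scattered_space X"
    and hp: "hereditarily_paracompact X"
  shows "classA X"
proof -
  note zd = compact_scattered_imp_zero_dimensional[OF X]
  have "classA (subtopology X (topspace X))"
  proof (rule scattered_clopen_induct[OF X(3) zd])
    fix V \<U>
    assume V: "clopenin X V" "V \<subseteq> \<Union>\<U>" and \<U>: "\<And>U. U \<in> \<U> \<Longrightarrow> openin X U"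
      and A: "\<And>U C. \<lbrakk>U \<in> \<U>; clopenin X C; C \<subseteq> U\<rbrakk> \<Longrightarrow> classA (subtopology X C)"
    \<comment> \<open>Small clopen sets inherit membership in the class from the members of
      \<open>\<U>\<close>. Compactness leaves finitely many of them, and their atoms partition
      \<open>V\<close>.\<close>
    define \<C> where "\<C> = {C. clopenin X C \<and> C \<subseteq> V \<and> (\<exists>U\<in>\<U>. C \<subseteq> U)}"
    have "V \<subseteq> \<Union>\<C>"
    proof
      fix x assume "x \<in> V"
      then obtain U where U: "U \<in> \<U>" "x \<in> V \<inter> U" using V by blast
      then have "openin X (V \<inter> U)" using V \<U> by (simp add: openin_Int)
      then obtain C where "clopenin X C" "x \<in> C" "C \<subseteq> V \<inter> U"
        using zero_dimensionalE[OF zd _ U(2)] by blast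
      then show "x \<in> \<Union>\<C>" using U(1) unfolding \<C>_def by blast
    qed
    moreover have "compactin X V" using V X(1) by (simp add: closedin_compact_space)
    moreover have "\<forall>C\<in>\<C>. openin X C" by (simp add: \<C>_def)
    ultimately obtain \<F> where \<F>: "finite \<F>" "\<F> \<subseteq> \<C>" "V \<subseteq> \<Union>\<F>"
      unfolding compactin_def by meson
    then have UF: "\<Union>\<F> = V" by (auto simp: \<C>_def)
    have "clopenin X C" if "C \<in> \<F>" for C using that \<F> by (auto simp: \<C>_def)
    then have "\<exists>\<D>. pairwise disjnt \<D> \<and> \<Union>\<D> = \<Union>\<F> \<and>
        (\<forall>D\<in>\<D>. clopenin X D) \<and> (\<forall>D\<in>\<D>. \<exists>C\<in>\<F>. D \<subseteq> C)"
      by (rule clopen_atoms) (use \<F>(1) in auto)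
    then obtain \<D> where \<D>: "pairwise disjnt \<D>" "\<Union>\<D> = \<Union>\<F>"
      "\<forall>D\<in>\<D>. clopenin X D" "\<forall>D\<in>\<D>. \<exists>C\<in>\<F>. D \<subseteq> C"
      by (elim exE conjE) (rule that)
    have "classA (subtopology X D)" if D: "D \<in> \<D>" for D
    proof -
      obtain C where "C \<in> \<F>" "D \<subseteq> C" using \<D>(4) D by blast
      moreover from this obtain U where "U \<in> \<U>" "C \<subseteq> U" using \<F>(2) unfolding \<C>_def by blast
      ultimately show ?thesis using A[of U D] \<D>(3) D by auto
    qed
    then show "classA (subtopology X V)"
      using \<D> UF by (intro classA_clopen_Union[OF X(1,2) V(1), of \<D>]) auto
  next
    fix V p
    assume V: "clopenin X V" "p \<in> V"
      and A: "\<And>C. \<lbrakk>clopenin X C; C \<subseteq> V - {p}\<rbrakk> \<Longrightarrow> classA (subtopology X C)"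
    have "V \<subseteq> topspace X" using V(1) openin_subset by metis
    then have "p \<in> topspace X" using V(2) by (rule subsetD)
    then have "closedin X {p}" by (rule closedin_Hausdorff_singleton[OF X(2)])
    then have "openin X (V - {p})" using V(1) by (simp add: openin_diff)
    moreover have "paracompact_space (subtopology X (V - {p}))"
      using hp \<open>V \<subseteq> topspace X\<close> unfolding hereditarily_paracompact_def by blast
    ultimately obtain \<D> where \<D>: "pairwise disjnt \<D>" "\<Union>\<D> = V - {p}" "\<And>D. D \<in> \<D> \<Longrightarrow> clopenin X D"
      using paracompact_open_clopen_partition[OF X(1,2) zd] by metis
    have "D \<subseteq> V - {p}" if "D \<in> \<D>" for D using \<D>(2) that by blast
    then show "classA (subtopology X V)"
      by (intro classA_clopen_insert_point[OF X(1,2) V \<D>(2,1)]) (simp add: A \<D>(3))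
  qed
  then show ?thesis by simp
qed

section \<open>Scattered metric spaces\<close>

text \<open>\<open>T x\<close> is the largest stage, not containing \<open>x\<close>, of the Cantor--Bendixson filtration by open sets.\<close>

lemma scattered_right_separated:
  assumes "scattered_space X"
  obtains T where "\<And>x. x \<in> topspace X \<Longrightarrow> openin X (insert x (T x))"
    and "\<And>x y. \<lbrakk>x \<in> topspace X; y \<in> topspace X; y \<in> T x\<rbrakk> \<Longrightarrow> x \<notin> T y"
proof -
  \<comment> \<open>\<open>D\<close> adds the points isolated in the complement of \<open>U\<close>.
    The family \<open>ccpo_class.iterates D\<close> is closed under \<open>D\<close> and under
    unions of chains, and thus replaces transfinite iteration over the ordinals.\<close>
  define D where "D U = U \<union> {x \<in> topspace X. \<exists>G. openin X G \<and> x \<in> G \<and> G \<subseteq> insert x U}" for U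
  let ?I = "ccpo_class.iterates D"
  have mono: "monotone (\<le>) (\<le>) D"
    unfolding monotone_def D_def by (simp; blast)
  have chain: "Complete_Partial_Order.chain (\<le>) ?I"
    by (rule chain_iterates[OF mono])
  have step: "D U \<in> ?I" if "U \<in> ?I" for U using that by (rule iterates.step)
  have op: "openin X U" if "U \<in> ?I" for U
    using that
  proof (induction rule: iterates.induct)
    case (step U)
    have "\<exists>G. openin X G \<and> x \<in> G \<and> G \<subseteq> D U" if "x \<in> D U" for x
      using that step.IH unfolding D_def by blast
    then show ?case by (subst openin_subopen) blast
  next
    case (Sup M)
    then show ?case by (intro openin_Union) auto
  qed
  define T where "T x = \<Union>{U \<in> ?I. x \<notin> U}" for x
  have T: "T x \<in> ?I" for x
    unfolding T_def
    by (rule iterates.Sup) (use chain in \<open>auto simp: Complete_Partial_Order.chain_def\<close>)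
  have notin: "x \<notin> T x" for x by (auto simp: T_def)
  \<comment> \<open>If \<open>x\<close> were not added right after \<open>T x\<close>, then
    \<open>D (T x)\<close> would be a stage missing \<open>x\<close> and hence contained in
    \<open>T x\<close>. But the nonempty complement of \<open>T x\<close> has an isolated point,
    which \<open>D\<close> adds.\<close>
  have in_D: "x \<in> D (T x)" if x: "x \<in> topspace X" for x
  proof (rule ccontr)
    assume "x \<notin> D (T x)"
    then have le: "D (T x) \<subseteq> T x" using step[OF T[of x]] unfolding T_def by blast
    obtain y G where "y \<in> topspace X - T x" "openin X G" "G \<inter> (topspace X - T x) = {y}"
      using assms x notin[of x] unfolding scattered_space_def
      by (metis DiffI Diff_subset empty_iff)
    moreover from this have "G \<subseteq> insert y (T x)" using openin_subset by blast
    ultimately have "y \<in> D (T x)" unfolding D_def by blast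
    then show False using le \<open>y \<in> topspace X - T x\<close> by blast
  qed
  show ?thesis
  proof (rule that[of T])
    fix x assume "x \<in> topspace X"
    then obtain G where G: "openin X G" "x \<in> G" "G \<subseteq> insert x (T x)"
      using in_D[of x] notin[of x] unfolding D_def by blast
    then have "insert x (T x) = G \<union> T x" by blast
    then show "openin X (insert x (T x))" using G(1) op[OF T[of x]] by (simp add: openin_Un)
  next
    fix x y assume "y \<in> T x"
    \<comment> \<open>Stages are comparable. The first inclusion would put \<open>y\<close> into
      \<open>T y\<close>, and under the second \<open>x\<close> is outside \<open>T y\<close>
      because it is outside \<open>T x\<close>.\<close>
    have "T x \<subseteq> T y \<or> T y \<subseteq> T x"
      using chainD[OF chain T[of x] T[of y]] by simp
    then show "x \<notin> T y" using \<open>y \<in> T x\<close> notin[of x] notin[of y] by blast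
  qed
qed

text \<open>The two disjoint closed sets are enlarged in countably many steps, each lying in the
  interior of the next, and step \<open>n\<close> absorbs \<open>A n\<close>. The two unions are
  then open and disjoint and cover the space, so they are clopen.\<close>

lemma sigma_discrete_clopen_separation:
  assumes "normal_space X" and cover: "topspace X = (\<Union>n::nat. A n)"
    and discrete: "\<And>n S. S \<subseteq> A n \<Longrightarrow> closedin X S"
    and PQ: "closedin X P" "closedin X Q" "P \<inter> Q = {}"
  obtains C where "clopenin X C" "P \<subseteq> C" "C \<inter> Q = {}"
proof -
  \<comment> \<open>Dependent choice only promises some initial element, so the clause for
    \<open>n = 0\<close> pins the start to \<open>(P, Q)\<close>.\<close>
  define good where "good n z \<longleftrightarrow> closedin X (fst z) \<and> closedin X (snd z) \<and> fst z \<inter> snd z = {} \<and>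
      (n = 0 \<longrightarrow> z = (P, Q))" for n :: nat and z :: "'a set \<times> 'a set"
  define nxt where "nxt n z w \<longleftrightarrow> fst z \<subseteq> X interior_of fst w \<and> snd z \<subseteq> X interior_of snd w \<and>
      A n \<subseteq> X interior_of fst w \<union> X interior_of snd w" for n :: nat and z w :: "'a set \<times> 'a set"
  have "\<exists>f. \<forall>n. good n (f n) \<and> nxt n (f n) (f (Suc n))"
  proof (rule dependent_nat_choice)
    show "\<exists>z. good 0 z" using PQ by (auto simp: good_def)
  next
    fix z n assume z: "good n z"
    \<comment> \<open>All points of \<open>A n\<close> not yet on the second side go to the first.
      The result is closed because every subset of \<open>A n\<close> is.\<close>
    let ?S = "fst z \<union> (A n - snd z)"
    have S: "closedin X ?S" using z discrete[of "A n - snd z" n] by (auto simp: good_def)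
    have "openin X (topspace X - snd z)" "?S \<subseteq> topspace X - snd z"
      using z closedin_subset[OF S] by (auto simp: good_def)
    then obtain G where G: "openin X G" "?S \<subseteq> G" "X closure_of G \<subseteq> topspace X - snd z"
      using S assms(1) unfolding normal_space_alt by metis
    have "openin X (topspace X - X closure_of G)" "closedin X (snd z)"
      "snd z \<subseteq> topspace X - X closure_of G"
      using z G closedin_subset[of X "snd z"] by (auto simp: good_def)
    then obtain H where H: "openin X H" "snd z \<subseteq> H" "X closure_of H \<subseteq> topspace X - X closure_of G"
      using assms(1) unfolding normal_space_alt by metis
    have "G \<subseteq> X interior_of (X closure_of G)" "H \<subseteq> X interior_of (X closure_of H)"
      using G(1) H(1) by (simp_all add: interior_of_maximal closure_of_subset openin_subset)
    moreover from this have "A n \<subseteq> X interior_of (X closure_of G) \<union> X interior_of (X closure_of H)"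
      using G(2) H(2) by blast
    ultimately show "\<exists>w. good (Suc n) w \<and> nxt n z w"
      using G H by (intro exI[of _ "(X closure_of G, X closure_of H)"]) (auto simp: good_def nxt_def)
  qed
  then obtain f where f: "\<And>n. good n (f n)" "\<And>n. nxt n (f n) (f (Suc n))" by blast
  define P' where "P' n = fst (f n)" for n
  define Q' where "Q' n = snd (f n)" for n
  have int: "P' n \<subseteq> X interior_of P' (Suc n)" "Q' n \<subseteq> X interior_of Q' (Suc n)"
    "A n \<subseteq> X interior_of P' (Suc n) \<union> X interior_of Q' (Suc n)" for n
    using f(2)[of n] by (auto simp: nxt_def P'_def Q'_def)
  have "incseq P'" "incseq Q'"
    using int(1,2) interior_of_subset by (metis incseq_SucI order_trans)+
  have "P' n \<inter> Q' m = {}" for n m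
  proof -
    have "P' n \<subseteq> P' (max n m)" "Q' m \<subseteq> Q' (max n m)"
      using \<open>incseq P'\<close> \<open>incseq Q'\<close> by (simp_all add: incseqD)
    then show ?thesis using f(1)[of "max n m"] by (auto simp: good_def P'_def Q'_def)
  qed
  then have disj: "(\<Union>n. P' n) \<inter> (\<Union>n. Q' n) = {}" by blast
  have "(\<Union>n. P' n) = (\<Union>n. X interior_of P' (Suc n))"
    using int(1) interior_of_subset[of X] by blast
  then have opP: "openin X (\<Union>n. P' n)" by (metis (no_types, lifting) openin_Union openin_interior_of imageE)
  have "(\<Union>n. Q' n) = (\<Union>n. X interior_of Q' (Suc n))"
    using int(2) interior_of_subset[of X] by blast
  then have opQ: "openin X (\<Union>n. Q' n)" by (metis (no_types, lifting) openin_Union openin_interior_of imageE)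
  have "topspace X \<subseteq> (\<Union>n. P' n) \<union> (\<Union>n. Q' n)"
  proof
    fix x assume "x \<in> topspace X"
    then obtain n where "x \<in> A n" using cover by blast
    then have "x \<in> P' (Suc n) \<union> Q' (Suc n)"
      using int(3)[of n] interior_of_subset[of X "P' (Suc n)"] interior_of_subset[of X "Q' (Suc n)"] by blast
    then show "x \<in> (\<Union>n. P' n) \<union> (\<Union>n. Q' n)" by blast
  qed
  then have "topspace X - (\<Union>n. P' n) = (\<Union>n. Q' n)"
    using disj openin_subset[OF opQ] by blast
  then have "clopenin X (\<Union>n. P' n)"
    using opP opQ openin_subset[OF opP] by (simp add: closedin_def)
  moreover have "P' 0 = P" "Q' 0 = Q" using f(1)[of 0] by (auto simp: good_def P'_def Q'_def)
  ultimately show ?thesis using that[of "\<Union>n. P' n"] disj by blast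
qed

section \<open>Uniformly separated sets in scattered metric spaces\<close>

context Metric_space
begin

text \<open>If a ball of radius s/6 met the sets of two different centres, these would be at
  distance less than s/3 + s/6 + s/6 + s/3 = s. So such a ball meets at most one of the sets, and
  the family is locally finite.\<close>

lemma closedin_separated_Union:
  assumes "s > 0" and sep: "\<And>x y. \<lbrakk>x \<in> S; y \<in> S; x \<noteq> y\<rbrakk> \<Longrightarrow> s \<le> d x y"
    and "S \<subseteq> M"
    and B: "\<And>x. x \<in> S \<Longrightarrow> closedin mtopology (B x)" "\<And>x. x \<in> S \<Longrightarrow> B x \<subseteq> mball x (s/3)"
  shows "closedin mtopology (\<Union>x\<in>S. B x)"
proof (rule closedin_locally_finite_Union)
  show "locally_finite_in mtopology (B ` S)"
    unfolding locally_finite_in_def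
  proof (intro conjI ballI)
    show "\<Union>(B ` S) \<subseteq> topspace mtopology"
      using B(1) closedin_subset by blast
    fix z assume z: "z \<in> topspace mtopology"
    have "x = y" if xy: "x \<in> S" "y \<in> S" "B x \<inter> mball z (s/6) \<noteq> {}" "B y \<inter> mball z (s/6) \<noteq> {}" for x y
    proof (rule ccontr)
      assume "x \<noteq> y"
      obtain u v where u: "u \<in> mball x (s/3)" "u \<in> mball z (s/6)"
        and v: "v \<in> mball y (s/3)" "v \<in> mball z (s/6)"
        using xy B(2) by blast
      then have "d x y \<le> d x u + d u z + (d z v + d v y)"
        by (smt (verit) in_mball triangle)
      then have "d x y < s" using u v by (simp add: commute)
      then show False using sep[OF xy(1,2) \<open>x \<noteq> y\<close>] by simp
    qed
    then have "\<exists>x. {V \<in> B ` S. V \<inter> mball z (s/6) \<noteq> {}} \<subseteq> {B x}"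
      by (smt (verit) imageE insertCI mem_Collect_eq subsetI)
    then have "finite {V \<in> B ` S. V \<inter> mball z (s/6) \<noteq> {}}"
      by (metis finite.emptyI finite.insertI finite_subset)
    then show "\<exists>V. openin mtopology V \<and> z \<in> V \<and> finite {U \<in> B ` S. U \<inter> V \<noteq> {}}"
      using z \<open>s > 0\<close>
      by (intro exI[of _ "mball z (s/6)"] conjI) auto
  qed
qed (use B in auto)

text \<open>The ball of radius \<open>r x\<close> around \<open>x\<close> contains, besides
  \<open>x\<close>, only points of \<open>T x\<close>. Two points with radii at least
  \<open>1 / Suc n\<close> that were closer than this would each lie in the stage of the other,
  which right separation forbids.\<close>

lemma scattered_sigma_separated:
  assumes "scattered_space mtopology"
  obtains A :: "nat \<Rightarrow> 'a set" where "M = (\<Union>n. A n)"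
    "\<And>n x y. \<lbrakk>x \<in> A n; y \<in> A n; x \<noteq> y\<rbrakk> \<Longrightarrow> 1 / Suc n \<le> d x y"
proof -
  obtain T where T: "\<And>x. x \<in> M \<Longrightarrow> openin mtopology (insert x (T x))"
    "\<And>x y. \<lbrakk>x \<in> M; y \<in> M; y \<in> T x\<rbrakk> \<Longrightarrow> x \<notin> T y"
    using scattered_right_separated[OF assms] unfolding topspace_mtopology by metis
  have "\<exists>r>0. mball x r \<subseteq> insert x (T x)" if "x \<in> M" for x
    using T(1)[OF that] unfolding openin_mtopology by blast
  then obtain r where r: "\<And>x. x \<in> M \<Longrightarrow> r x > 0" "\<And>x. x \<in> M \<Longrightarrow> mball x (r x) \<subseteq> insert x (T x)"
    by metis
  show ?thesis
  proof (rule that[of "\<lambda>n. {x \<in> M. 1 / Suc n \<le> r x}"])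
    show "M = (\<Union>n. {x \<in> M. 1 / Suc n \<le> r x})"
    proof (intro equalityI subsetI)
      fix x assume "x \<in> M"
      moreover from this obtain n where "1 / Suc n < r x" using r(1) nat_approx_posE by metis
      ultimately have "x \<in> {x \<in> M. 1 / Suc n \<le> r x}" by simp
      then show "x \<in> (\<Union>n. {x \<in> M. 1 / Suc n \<le> r x})" by blast
    qed auto
    fix n x y assume xy: "x \<in> {x \<in> M. 1 / Suc n \<le> r x}" "y \<in> {x \<in> M. 1 / Suc n \<le> r x}" "x \<noteq> y"
    show "1 / Suc n \<le> d x y"
    proof (rule ccontr)
      assume "\<not> ?thesis"
      then have "y \<in> mball x (r x)" "x \<in> mball y (r y)" using xy by (auto simp: commute)
      then have "y \<in> insert x (T x)" "x \<in> insert y (T y)" using r(2) xy by blast+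
      then have "y \<in> T x" "x \<in> T y" using xy(3) by auto
      then show False using T(2) xy by blast
    qed
  qed
qed

text \<open>Every subset of a uniformly separated set is closed, so
  \<open>sigma_discrete_clopen_separation\<close> applies to \<open>{x}\<close> and the complement
  of \<open>U\<close>.\<close>

lemma scattered_imp_zero_dimensional:
  assumes "scattered_space mtopology"
  shows "zero_dimensional mtopology"
  unfolding zero_dimensional_def
proof (intro allI impI, elim conjE)
  fix U x assume U: "openin mtopology U" "x \<in> U"
  obtain A where A: "M = (\<Union>n. A n)"
    "\<And>n x y. \<lbrakk>x \<in> A n; y \<in> A n; x \<noteq> y\<rbrakk> \<Longrightarrow> 1 / Suc n \<le> d x y"
    using scattered_sigma_separated[OF assms] by metis
  have "closedin mtopology S" if "S \<subseteq> A n" for S n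
  proof -
    have "S \<subseteq> M" using that A(1) by blast
    then have "closedin mtopology (\<Union>x\<in>S. {x})"
    proof (intro closedin_separated_Union[where s = "1 / Suc n"])
      show "1 / Suc n \<le> d x y" if "x \<in> S" "y \<in> S" "x \<noteq> y" for x y
        using A(2) that \<open>S \<subseteq> A n\<close> by blast
      show "closedin mtopology {x}" if "x \<in> S" for x
        using that \<open>S \<subseteq> M\<close> by (auto intro!: closedin_Hausdorff_singleton Hausdorff_space_mtopology)
    qed auto
    then show ?thesis by simp
  qed
  moreover have "closedin mtopology {x}"
    using U openin_subset by (intro closedin_Hausdorff_singleton Hausdorff_space_mtopology) blast
  moreover have "closedin mtopology (M - U)"
    using U(1) by (metis closedin_diff closedin_topspace topspace_mtopology)
  moreover have "{x} \<inter> (M - U) = {}" using U by blast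
  moreover have "normal_space mtopology"
    by (intro metrizable_imp_normal_space metrizable_space_mtopology)
  ultimately obtain C where "clopenin mtopology C" "{x} \<subseteq> C" "C \<inter> (M - U) = {}"
    using sigma_discrete_clopen_separation[of mtopology A "{x}" "M - U"] A(1) by (metis topspace_mtopology)
  moreover from this have "C \<subseteq> U" using openin_subset[of mtopology C] by auto
  ultimately show "\<exists>C. clopenin mtopology C \<and> x \<in> C \<and> C \<subseteq> U" by blast
qed

text \<open>Each point of \<open>A n\<close> gets a clopen set within a third of the separation
  constant and inside a member of the cover. The third makes these sets disjoint for fixed
  \<open>n\<close> and their union \<open>F n\<close> closed; overlaps between different
  \<open>n\<close> are resolved in favour of the smaller one.\<close>

lemma scattered_disjoint_refinement:
  assumes "scattered_space mtopology" and \<U>: "\<And>U. U \<in> \<U> \<Longrightarrow> openin mtopology U" "M \<subseteq> \<Union>\<U>"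
  shows "\<exists>\<V>. pairwise disjnt \<V> \<and> \<Union>\<V> = M \<and> (\<forall>V\<in>\<V>. openin mtopology V) \<and>
    (\<forall>V\<in>\<V>. \<exists>U\<in>\<U>. V \<subseteq> U)"
proof -
  obtain A where A: "M = (\<Union>n. A n)"
    "\<And>n x y. \<lbrakk>x \<in> A n; y \<in> A n; x \<noteq> y\<rbrakk> \<Longrightarrow> 1 / Suc n \<le> d x y"
    using scattered_sigma_separated[OF assms(1)] by metis
  have "\<exists>B. clopenin mtopology B \<and> x \<in> B \<and> B \<subseteq> mball x ((1 / Suc n) / 3) \<and> (\<exists>U\<in>\<U>. B \<subseteq> U)"
    if x: "x \<in> M" for x n
  proof -
    obtain U where U: "U \<in> \<U>" "x \<in> U" using \<U>(2) x by blast
    have "openin mtopology (U \<inter> mball x ((1 / Suc n) / 3))"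
      by (intro openin_Int \<U>(1)[OF U(1)] openin_mball)
    moreover have "x \<in> U \<inter> mball x ((1 / Suc n) / 3)" using U x by simp
    ultimately obtain B where "clopenin mtopology B" "x \<in> B" "B \<subseteq> U \<inter> mball x ((1 / Suc n) / 3)"
      by (rule zero_dimensionalE[OF scattered_imp_zero_dimensional[OF assms(1)]])
    then show ?thesis using U by blast
  qed
  note ex = this
  define B where "B n x = (SOME B. clopenin mtopology B \<and> x \<in> B \<and>
      B \<subseteq> mball x ((1 / Suc n) / 3) \<and> (\<exists>U\<in>\<U>. B \<subseteq> U))" for n x
  have B: "clopenin mtopology (B n x)" "x \<in> B n x" "B n x \<subseteq> mball x ((1 / Suc n) / 3)" "\<exists>U\<in>\<U>. B n x \<subseteq> U"
    if "x \<in> M" for n x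
    using someI_ex[OF ex[OF that, of n]] unfolding B_def by simp_all
  have AM: "A n \<subseteq> M" for n using A(1) by blast
  define F where "F n = (\<Union>x\<in>A n. B n x)" for n
  have F: "closedin mtopology (F n)" for n
    unfolding F_def
  proof (rule closedin_separated_Union[where s = "1 / Suc n"])
    fix x assume "x \<in> A n"
    then have "x \<in> M" using AM by blast
    then show "closedin mtopology (B n x)" "B n x \<subseteq> mball x (1 / Suc n / 3)" using B(1,3) by simp_all
  qed (use A(2) AM in auto)
  \<comment> \<open>A point is assigned to the first \<open>F n\<close> that contains it. Only
    finitely many closed sets are removed, so the pieces remain open.\<close>
  define V where "V n x = B n x - (\<Union>m<n. F m)" for n x
  have disjB: "disjnt (B n x) (B n y)" if xy: "x \<in> A n" "y \<in> A n" "x \<noteq> y" for n x y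
  proof (rule ccontr)
    assume "\<not> ?thesis"
    moreover have "x \<in> M" "y \<in> M" using xy AM by blast+
    ultimately obtain z where "z \<in> mball x ((1 / Suc n) / 3)" "z \<in> mball y ((1 / Suc n) / 3)"
      using B(3)[of x n] B(3)[of y n] unfolding disjnt_iff by blast
    then have "d x z < (1 / Suc n) / 3" "d z y < (1 / Suc n) / 3" "d x y \<le> d x z + d z y"
      by (auto simp only: in_mball commute[of z y] intro: triangle[of x z y, unfolded commute[of z y]])
    moreover have "0 < 1 / real (Suc n)" by simp
    ultimately have "d x y < 1 / Suc n" by linarith
    then show False using A(2)[OF xy] by simp
  qed
  have disjV: "disjnt (V n x) (V m y)" if "n < m" "x \<in> A n" for n m x y
    using that unfolding disjnt_iff V_def F_def by blast
  define \<V> where "\<V> = (\<Union>n. V n ` A n)"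
  show ?thesis
  proof (intro exI[of _ \<V>] conjI ballI)
    show "pairwise disjnt \<V>"
    proof (rule pairwiseI)
      fix P Q assume "P \<in> \<V>" "Q \<in> \<V>" "P \<noteq> Q"
      then obtain n x m y where P: "P = V n x" "x \<in> A n" "Q = V m y" "y \<in> A m"
        by (auto simp: \<V>_def)
      consider "n < m" | "m < n" | "n = m" "x \<noteq> y" using P \<open>P \<noteq> Q\<close> by fastforce
      then show "disjnt P Q"
      proof cases
        case 3
        then show ?thesis using disjB P by (auto simp: V_def disjnt_iff)
      qed (use disjV P in \<open>auto simp: disjnt_sym\<close>)
    qed
    show op: "openin mtopology W" if W: "W \<in> \<V>" for W
    proof -
      obtain n x where "W = V n x" "x \<in> M" using W AM by (auto simp: \<V>_def)
      then show ?thesis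
        unfolding V_def using B(1) F by (auto intro!: openin_diff closedin_Union)
    qed
    show "\<Union>\<V> = M"
    proof (intro equalityI)
      show "\<Union>\<V> \<subseteq> M"
        using op openin_subset topspace_mtopology by blast
      show "M \<subseteq> \<Union>\<V>"
      proof
        fix x assume x: "x \<in> M"
        then have "\<exists>n. x \<in> F n" using A(1) B(2) AM unfolding F_def by blast
        then obtain n where n: "x \<in> F n" "\<And>m. m < n \<Longrightarrow> x \<notin> F m"
          using exists_least_iff[of "\<lambda>n. x \<in> F n"] by auto
        then show "x \<in> \<Union>\<V>" unfolding \<V>_def V_def F_def by blast
      qed
    qed
    show "\<exists>U\<in>\<U>. W \<subseteq> U" if W: "W \<in> \<V>" for W
    proof -
      obtain n x where "W = V n x" "x \<in> M" using W AM by (auto simp: \<V>_def)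
      moreover from this obtain U where "U \<in> \<U>" "B n x \<subseteq> U" using B(4) by meson
      ultimately show ?thesis unfolding V_def by blast
    qed
  qed
qed

lemma clopen_decreasing_base:
  assumes "zero_dimensional mtopology" "clopenin mtopology V" "p \<in> V"
  obtains C :: "nat \<Rightarrow> 'a set" where "C 0 = V" "decseq C"
    "\<And>n. clopenin mtopology (C n)" "\<And>n. p \<in> C n"
    "\<And>U. \<lbrakk>openin mtopology U; p \<in> U\<rbrakk> \<Longrightarrow> \<exists>n. C n \<subseteq> U"
proof -
  have p: "p \<in> M" using assms openin_subset by fastforce
  have "\<exists>E. clopenin mtopology E \<and> p \<in> E \<and> E \<subseteq> mball p (1 / Suc n)" for n
    using zero_dimensionalE[OF assms(1), of "mball p (1 / Suc n)" p] p by auto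
  then obtain E where E: "\<And>n::nat. clopenin mtopology (E n)" "\<And>n. p \<in> E n" "\<And>n. E n \<subseteq> mball p (1 / Suc n)"
    by metis
  \<comment> \<open>The bound is \<open>i < n\<close>, so \<open>C 0\<close> is \<open>V\<close>
    itself and the differences of consecutive terms fill all of \<open>V\<close> except
    \<open>p\<close>.\<close>
  define C where "C n = V \<inter> (\<Inter>i<n. E i)" for n
  show ?thesis
  proof (rule that[of C])
    show "decseq C" unfolding C_def decseq_def by (auto simp: le_eq_less_or_eq)
    show "clopenin mtopology (C n)" for n
    proof (induction n)
      case (Suc n)
      have "C (Suc n) = C n \<inter> E n" by (auto simp: C_def less_Suc_eq)
      then show ?case using Suc E(1) clopenin_Int by metis
    qed (use assms in \<open>simp add: C_def\<close>)
    fix U assume "openin mtopology U" "p \<in> U"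
    then obtain r where r: "r > 0" "mball p r \<subseteq> U" unfolding openin_mtopology by blast
    then obtain n where "1 / Suc n < r" using nat_approx_posE by metis
    then have "C (Suc n) \<subseteq> U"
    proof -
      have "C (Suc n) \<subseteq> E n" by (auto simp: C_def)
      also have "E n \<subseteq> mball p (1 / Suc n)" by (rule E(3))
      also have "\<dots> \<subseteq> mball p r" using \<open>1 / Suc n < r\<close> by (intro mball_subset_concentric) simp
      finally show ?thesis using r(2) by simp
    qed
    then show "\<exists>n. C n \<subseteq> U" by blast
  qed (use assms E in \<open>auto simp: C_def\<close>)
qed

end

section \<open>Trees of clopen sets\<close>

text \<open>The fourth clause excludes infinite descending chains of nodes, the fifth one gives every node only
  finitely many ancestors.\<close>

definition node_tree :: "'a topology \<Rightarrow> 'a set \<Rightarrow> 'a set set \<Rightarrow> bool" where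
  "node_tree X V \<N> \<longleftrightarrow> V \<in> \<N> \<and>
     (\<forall>N\<in>\<N>. clopenin X N \<and> N \<noteq> {} \<and> N \<subseteq> V) \<and>
     (\<forall>M\<in>\<N>. \<forall>N\<in>\<N>. M \<subseteq> N \<or> N \<subseteq> M \<or> M \<inter> N = {}) \<and>
     (\<forall>\<Q>\<subseteq>\<N>. \<Q> \<noteq> {} \<longrightarrow> (\<exists>M\<in>\<Q>. \<forall>N\<in>\<Q>. \<not> N \<subset> M)) \<and>
     (\<forall>N\<in>\<N>. finite {M \<in> \<N>. N \<subseteq> M}) \<and>
     (\<forall>U x. openin X U \<and> x \<in> U \<inter> V \<longrightarrow>
        (\<exists>N\<in>\<N>. \<exists>\<F>\<subseteq>\<N>. finite \<F> \<and> x \<in> N - \<Union>\<F> \<and> N - \<Union>\<F> \<subseteq> U))"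

text \<open>\<open>V\<close> becomes a root above the trees of the pieces. The premise
  \<open>rest\<close> supplies the base clause at points outside all pieces: it is vacuous when the
  pieces cover \<open>V\<close>, and otherwise describes the neighbourhoods of the limit
  point.\<close>

lemma node_tree_glue:
  assumes V: "clopenin X V" "V \<noteq> {}"
    and \<D>: "pairwise disjnt \<D>" "\<Union>\<D> \<subseteq> V"
    and tree: "\<And>D. D \<in> \<D> \<Longrightarrow> \<exists>\<N>. node_tree X D \<N>"
    and rest: "\<And>U x. \<lbrakk>openin X U; x \<in> U; x \<in> V - \<Union>\<D>\<rbrakk> \<Longrightarrow> \<exists>\<F>\<subseteq>\<D>. finite \<F> \<and> V - \<Union>\<F> \<subseteq> U"
  shows "\<exists>\<N>. node_tree X V \<N>"
proof -
  obtain T where T: "\<And>D. D \<in> \<D> \<Longrightarrow> node_tree X D (T D)" using tree by metis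
  have root: "D \<in> T D" if "D \<in> \<D>" for D
    using T[OF that] unfolding node_tree_def by blast
  have mem: "clopenin X N" "N \<noteq> {}" "N \<subseteq> D" if "D \<in> \<D>" "N \<in> T D" for D N
    using T[OF that(1)] that(2) unfolding node_tree_def by simp_all
  have nested: "M \<subseteq> N \<or> N \<subseteq> M \<or> M \<inter> N = {}" if "D \<in> \<D>" "M \<in> T D" "N \<in> T D" for D M N
    using T[OF that(1)] that(2,3) unfolding node_tree_def by simp
  have minimal: "\<exists>M\<in>\<Q>. \<forall>N\<in>\<Q>. \<not> N \<subset> M" if "D \<in> \<D>" "\<Q> \<subseteq> T D" "\<Q> \<noteq> {}" for D \<Q>
    using T[OF that(1)] that(2,3) unfolding node_tree_def by simp
  have finsup: "finite {M \<in> T D. N \<subseteq> M}" if "D \<in> \<D>" "N \<in> T D" for D N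
    using T[OF that(1)] that(2) unfolding node_tree_def by simp
  have base: "\<exists>N\<in>T D. \<exists>\<F>\<subseteq>T D. finite \<F> \<and> x \<in> N - \<Union>\<F> \<and> N - \<Union>\<F> \<subseteq> U"
    if "D \<in> \<D>" "openin X U" "x \<in> U" "x \<in> D" for D U x
    using T[OF that(1)] that(2-4) unfolding node_tree_def by simp
  \<comment> \<open>Pieces are disjoint and nodes nonempty, so a node lies below only one piece.
    This reduces the clauses for the whole family to those of a single tree.\<close>
  have same: "D = D'" if "D \<in> \<D>" "D' \<in> \<D>" "N \<noteq> {}" "N \<subseteq> D" "N \<subseteq> D'" for D D' N
    using \<D>(1) that unfolding pairwise_def disjnt_def by blast
  have DV: "D \<subseteq> V" if "D \<in> \<D>" for D using that \<D>(2) by blast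
  define \<N> where "\<N> = insert V (\<Union>D\<in>\<D>. T D)"
  have NE: "N = V \<or> (\<exists>D\<in>\<D>. N \<in> T D)" if "N \<in> \<N>" for N using that by (auto simp: \<N>_def)
  have "\<forall>N\<in>\<N>. clopenin X N \<and> N \<noteq> {} \<and> N \<subseteq> V"
  proof
    fix N assume "N \<in> \<N>"
    then consider "N = V" | D where "D \<in> \<D>" "N \<in> T D" using NE by blast
    then show "clopenin X N \<and> N \<noteq> {} \<and> N \<subseteq> V"
    proof cases
      case 2
      then show ?thesis using mem[OF 2] DV[OF 2(1)] by auto
    qed (use V in simp)
  qed
  moreover have "\<forall>M\<in>\<N>. \<forall>N\<in>\<N>. M \<subseteq> N \<or> N \<subseteq> M \<or> M \<inter> N = {}"
  proof (intro ballI)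
    fix M N assume MN: "M \<in> \<N>" "N \<in> \<N>"
    have sub: "M \<subseteq> V" "N \<subseteq> V" using calculation MN by simp_all
    show "M \<subseteq> N \<or> N \<subseteq> M \<or> M \<inter> N = {}"
    proof (cases "M = V \<or> N = V")
      case True
      then show ?thesis using sub by blast
    next
      case False
      then obtain D D' where D: "D \<in> \<D>" "M \<in> T D" "D' \<in> \<D>" "N \<in> T D'" using NE MN by metis
      show ?thesis
      proof (cases "D = D'")
        case True
        then show ?thesis using nested D by blast
      next
        case False
        then have "D \<inter> D' = {}" using \<D>(1) D by (simp add: pairwise_def disjnt_def)
        then show ?thesis using mem(3)[OF D(1,2)] mem(3)[OF D(3,4)] by blast
      qed
    qed
  qed
  moreover have "\<forall>\<Q>\<subseteq>\<N>. \<Q> \<noteq> {} \<longrightarrow> (\<exists>M\<in>\<Q>. \<forall>N\<in>\<Q>. \<not> N \<subset> M)"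
  proof (intro allI impI)
    fix \<Q> assume \<Q>: "\<Q> \<subseteq> \<N>" "\<Q> \<noteq> {}"
    show "\<exists>M\<in>\<Q>. \<forall>N\<in>\<Q>. \<not> N \<subset> M"
    proof (cases "\<exists>D\<in>\<D>. \<Q> \<inter> T D \<noteq> {}")
      case True
      then obtain D where D: "D \<in> \<D>" "\<Q> \<inter> T D \<noteq> {}" by blast
      \<comment> \<open>Minimality within one tree suffices: anything strictly smaller than
        \<open>M\<close> is contained in \<open>D\<close>, hence comes from the same tree.\<close>
      obtain M where M: "M \<in> \<Q> \<inter> T D" "\<forall>N\<in>\<Q> \<inter> T D. \<not> N \<subset> M"
        using minimal[OF D(1) _ D(2)] by blast
      have "\<not> N \<subset> M" if N: "N \<in> \<Q>" for N
      proof
        assume NM: "N \<subset> M"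
        then have ND: "N \<subseteq> D" using mem(3)[OF D(1)] M(1) by blast
        have "N \<noteq> V" using NM mem(3)[OF D(1)] M(1) DV[OF D(1)] by blast
        then obtain D' where D': "D' \<in> \<D>" "N \<in> T D'" using NE N \<Q> by blast
        then have "D = D'" using same[OF D(1) D'(1) mem(2)[OF D'] ND mem(3)[OF D']] by simp
        then show False using D' N NM M(2) by blast
      qed
      then show ?thesis using M(1) by blast
    next
      case False
      then have "\<Q> = {V}" using \<Q> NE by blast
      then show ?thesis by simp
    qed
  qed
  moreover have "\<forall>N\<in>\<N>. finite {M \<in> \<N>. N \<subseteq> M}"
  proof
    fix N assume N: "N \<in> \<N>"
    show "finite {M \<in> \<N>. N \<subseteq> M}"
    proof (cases "N = V")
      case True
      have "{M \<in> \<N>. N \<subseteq> M} \<subseteq> {V}" using calculation(1) True by auto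
      then show ?thesis by (rule finite_subset) simp
    next
      case False
      then obtain D where D: "D \<in> \<D>" "N \<in> T D" using NE N by blast
      have "{M \<in> \<N>. N \<subseteq> M} \<subseteq> insert V {M \<in> T D. N \<subseteq> M}"
      proof
        fix M assume M: "M \<in> {M \<in> \<N>. N \<subseteq> M}"
        show "M \<in> insert V {M \<in> T D. N \<subseteq> M}"
        proof (cases "M = V")
          case False
          then obtain D' where D': "D' \<in> \<D>" "M \<in> T D'" using NE M by blast
          have "N \<subseteq> D'" using M mem(3)[OF D'] by blast
          then have "D = D'" using same[OF D(1) D'(1) mem(2)[OF D] mem(3)[OF D]] by simp
          then show ?thesis using M D' by blast
        qed simp
      qed
      then show ?thesis by (rule finite_subset) (use finsup[OF D] in simp)
    qed
  qed
  moreover have "\<forall>U x. openin X U \<and> x \<in> U \<inter> V \<longrightarrow>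
        (\<exists>N\<in>\<N>. \<exists>\<F>\<subseteq>\<N>. finite \<F> \<and> x \<in> N - \<Union>\<F> \<and> N - \<Union>\<F> \<subseteq> U)"
  proof (intro allI impI, elim conjE)
    fix U x assume U: "openin X U" "x \<in> U \<inter> V"
    show "\<exists>N\<in>\<N>. \<exists>\<F>\<subseteq>\<N>. finite \<F> \<and> x \<in> N - \<Union>\<F> \<and> N - \<Union>\<F> \<subseteq> U"
    proof (cases "x \<in> \<Union>\<D>")
      case True
      then obtain D where D: "D \<in> \<D>" "x \<in> D" by blast
      have "T D \<subseteq> \<N>" using D by (auto simp: \<N>_def)
      then show ?thesis using base[OF D(1) U(1) _ D(2)] U(2) by (meson IntD1 order_trans subsetD)
    next
      case False
      then obtain \<F> where \<F>: "\<F> \<subseteq> \<D>" "finite \<F>" "V - \<Union>\<F> \<subseteq> U" using rest[of U x] U by blast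
      have "\<F> \<subseteq> \<N>" using \<F>(1) root by (auto simp: \<N>_def)
      moreover have "x \<in> V - \<Union>\<F>" using False U \<F>(1) by blast
      moreover have "V \<in> \<N>" by (simp add: \<N>_def)
      ultimately show ?thesis using \<F> by blast
    qed
  qed
  moreover have "V \<in> \<N>" by (simp add: \<N>_def)
  ultimately show ?thesis unfolding node_tree_def by blast
qed

lemma (in Metric_space) scattered_node_tree:
  assumes scat: "scattered_space mtopology" and "M \<noteq> {}"
  shows "\<exists>\<N>. node_tree mtopology M \<N>"
proof -
  let ?P = "\<lambda>V. V \<noteq> {} \<longrightarrow> (\<exists>\<N>. node_tree mtopology V \<N>)"
  note zd = scattered_imp_zero_dimensional[OF scat]
  have "?P (topspace mtopology)"
  proof (rule scattered_clopen_induct[OF scat zd], goal_cases)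
    case (1 V \<U>)
    show ?case
    proof
      assume "V \<noteq> {}"
      have V: "openin mtopology V" "openin mtopology (M - V)" "V \<subseteq> M"
        using 1(1) openin_subset[of mtopology V] openin_diff[of mtopology M V] openin_topspace[of mtopology]
        by auto
      \<comment> \<open>Disjoint refinement is available for covers of the whole space, so the
        complement of \<open>V\<close> is added. Members of the refinement that meet
        \<open>V\<close> are then forced into some \<open>U \<inter> V\<close>.\<close>
      let ?\<U> = "insert (M - V) ((\<lambda>U. U \<inter> V) ` \<U>)"
      have "\<And>U. U \<in> ?\<U> \<Longrightarrow> openin mtopology U" using V 1(3) by (auto simp: openin_Int)
      moreover have "M \<subseteq> \<Union>?\<U>" using 1(2) by blast
      ultimately have "\<exists>\<V>. pairwise disjnt \<V> \<and> \<Union>\<V> = M \<and> (\<forall>W\<in>\<V>. openin mtopology W) \<and>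
          (\<forall>W\<in>\<V>. \<exists>U\<in>?\<U>. W \<subseteq> U)"
        by (rule scattered_disjoint_refinement[OF scat])
      then obtain \<V> where \<V>: "pairwise disjnt \<V>" "\<Union>\<V> = M" "\<forall>W\<in>\<V>. openin mtopology W"
        "\<forall>W\<in>\<V>. \<exists>U\<in>?\<U>. W \<subseteq> U"
        by (elim exE conjE) (rule that)
      define \<D> where "\<D> = {D \<in> \<V>. D \<inter> V \<noteq> {}}"
      have sub: "\<exists>U\<in>\<U>. D \<subseteq> U \<inter> V" if "D \<in> \<D>" for D
      proof -
        have "D \<in> \<V>" "D \<inter> V \<noteq> {}" using that by (simp_all add: \<D>_def)
        then show ?thesis using \<V>(4) by blast
      qed
      have clop: "clopenin mtopology D" if D: "D \<in> \<D>" for D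
      proof -
        have "D \<in> \<V>" using D by (simp add: \<D>_def)
        then have "M - D = \<Union>(\<V> - {D})"
          using \<V>(1,2) by (auto simp: pairwise_def disjnt_iff)
        moreover have "openin mtopology (\<Union>(\<V> - {D}))" using \<V>(3) by blast
        ultimately show ?thesis using \<V>(2,3) \<open>D \<in> \<V>\<close> by (auto simp: closedin_def)
      qed
      have "\<Union>\<D> = V"
      proof
        show "\<Union>\<D> \<subseteq> V" using sub by blast
        show "V \<subseteq> \<Union>\<D>" using \<V>(2) V(3) unfolding \<D>_def by blast
      qed
      moreover have "\<exists>\<N>. node_tree mtopology D \<N>" if D: "D \<in> \<D>" for D
      proof -
        obtain U where "U \<in> \<U>" "D \<subseteq> U" using sub[OF D] by blast
        moreover have "D \<noteq> {}" using D by (auto simp: \<D>_def)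
        ultimately show ?thesis using 1(4)[of U D] clop[OF D] by simp
      qed
      moreover have "pairwise disjnt \<D>" using \<V>(1) unfolding \<D>_def by (auto simp: pairwise_def)
      ultimately show "\<exists>\<N>. node_tree mtopology V \<N>"
        by (intro node_tree_glue[OF 1(1) \<open>V \<noteq> {}\<close>, of \<D>]) simp_all
    qed
  next
    case (2 V p)
    obtain C :: "nat \<Rightarrow> 'a set" where C: "C 0 = V" "decseq C"
      "\<And>n. clopenin mtopology (C n)" "\<And>n. p \<in> C n"
      "\<And>U. \<lbrakk>openin mtopology U; p \<in> U\<rbrakk> \<Longrightarrow> \<exists>n. C n \<subseteq> U"
      using clopen_decreasing_base[OF zd 2(1,2)] by blast
    \<comment> \<open>The shells between consecutive members of the base partition
      \<open>V - {p}\<close>. Removing the first \<open>n\<close> of them leaves only points of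
      \<open>C n\<close>, which is what the base clause at \<open>p\<close> demands. Empty shells
      are dropped because nodes are nonempty.\<close>
    define \<D> where "\<D> = range (\<lambda>n. C n - C (Suc n)) - {{}}"
    have CV: "C n \<subseteq> V" for n using decseqD[OF C(2), of 0 n] C(1) by simp
    have telescope: "V - \<Union>((\<lambda>n. C n - C (Suc n)) ` {..<n}) \<subseteq> C n" for n
      by (induction n) (auto simp: C(1) lessThan_Suc)
    have rest: "V - \<Union>\<D> \<subseteq> {p}"
    proof
      fix x assume x: "x \<in> V - \<Union>\<D>"
      have "x \<in> C n" for n
        by (induction n) (use x C(1) in \<open>auto simp: \<D>_def\<close>)
      moreover have "x \<in> M" using x 2(1) openin_subset[of mtopology V] by auto
      ultimately show "x \<in> {p}"
        using C(5)[of "M - {x}"] 2(1,2) openin_subset[of mtopology V]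
          closedin_Hausdorff_singleton[OF Hausdorff_space_mtopology, of x]
          openin_diff[of mtopology M "{x}"] openin_topspace[of mtopology] by auto
    qed
    have disj: "disjnt (C m - C (Suc m)) (C n - C (Suc n))" if "m < n" for m n
      using decseqD[OF C(2), of "Suc m" n] that by (auto simp: disjnt_iff)
    have "\<exists>\<N>. node_tree mtopology V \<N>"
    proof (rule node_tree_glue)
      show "pairwise disjnt \<D>"
      proof (rule pairwiseI)
        fix P Q assume "P \<in> \<D>" "Q \<in> \<D>" "P \<noteq> Q"
        then obtain m n where "P = C m - C (Suc m)" "Q = C n - C (Suc n)" by (auto simp: \<D>_def)
        then show "disjnt P Q" using \<open>P \<noteq> Q\<close> disj disjnt_sym by (metis linorder_neqE_nat)
      qed
      show "\<Union>\<D> \<subseteq> V" using CV by (auto simp: \<D>_def)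
      fix D assume "D \<in> \<D>"
      then obtain n where D: "D = C n - C (Suc n)" "D \<noteq> {}" by (auto simp: \<D>_def)
      have "clopenin mtopology D" unfolding D(1) using C(3) clopenin_Diff by metis
      moreover have "D \<subseteq> V - {p}" using D(1) CV C(4) by blast
      ultimately show "\<exists>\<N>. node_tree mtopology D \<N>" using 2(3)[of D] D(2) by simp
    next
      fix U x assume U: "openin mtopology U" "x \<in> U" "x \<in> V - \<Union>\<D>"
      then have "p \<in> U" using rest by blast
      then obtain n where n: "C n \<subseteq> U" using C(5) U(1) by blast
      let ?F = "(\<lambda>n. C n - C (Suc n)) ` {..<n} - {{}}"
      have "\<Union>?F = \<Union>((\<lambda>n. C n - C (Suc n)) ` {..<n})" by blast
      then have "V - \<Union>?F \<subseteq> U" using telescope[of n] n by simp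
      moreover have "?F \<subseteq> \<D>" by (auto simp: \<D>_def)
      ultimately show "\<exists>\<F>\<subseteq>\<D>. finite \<F> \<and> V - \<Union>\<F> \<subseteq> U" by (intro exI[of _ ?F]) auto
    qed (use 2 in auto)
    then show ?case by simp
  qed
  then show ?thesis using \<open>M \<noteq> {}\<close> by simp
qed

section \<open>Uniform Eberlein compactness\<close>

text \<open>\<open>N x\<close> is the node whose point at infinity is \<open>x\<close>, and \<open>d x\<close> is its depth in the tree.\<close>

lemma classA_tree_marking:
  assumes "classA X"
  shows "\<exists>(N :: 'a \<Rightarrow> 'a set) (d :: 'a \<Rightarrow> nat).
     (\<forall>x\<in>topspace X. x \<in> N x \<and> clopenin X (N x)) \<and>
     (\<forall>x\<in>topspace X. \<forall>y\<in>topspace X. x \<noteq> y \<longrightarrow>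
        (y \<in> N x \<longrightarrow> x \<notin> N y) \<and> (d x = d y \<longrightarrow> disjnt (N x) (N y)))"
  using assms
proof (induction rule: classA.induct)
  case (empty X)
  then show ?case by simp
next
  case (point X p)
  then show ?case
    by (intro exI[of _ "\<lambda>_. topspace X"]) (metis closedin_topspace openin_topspace singletonD)
next
  case (alex X Y \<F>)
  have clop: "clopenin X F" if "F \<in> \<F>" for F
    using that alex compact_summand_clopenin classA_imp_compact_space by metis
  have top: "topspace (subtopology X F) = F" if "F \<in> \<F>" for F
    using clop[OF that] by (metis openin_subset topspace_subtopology_subset)
  obtain N0 :: "'a set \<Rightarrow> 'a \<Rightarrow> 'a set" and d0 :: "'a set \<Rightarrow> 'a \<Rightarrow> nat"
    where IH: "\<And>F. F \<in> \<F> \<Longrightarrow>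
     (\<forall>x\<in>F. x \<in> N0 F x \<and> clopenin (subtopology X F) (N0 F x)) \<and>
     (\<forall>x\<in>F. \<forall>y\<in>F. x \<noteq> y \<longrightarrow>
      (y \<in> N0 F x \<longrightarrow> x \<notin> N0 F y) \<and> (d0 F x = d0 F y \<longrightarrow> disjnt (N0 F x) (N0 F y)))"
    using alex.IH top by metis
  define S where "S x = (THE F. F \<in> \<F> \<and> x \<in> F)" for x
  have S: "S x = F" if "F \<in> \<F>" "x \<in> F" for x F
    unfolding S_def
    by (rule the_equality) (use that \<open>pairwise disjnt \<F>\<close> in \<open>auto simp: pairwise_def disjnt_iff\<close>)
  \<comment> \<open>The point at infinity receives the whole space at depth 0, and depths inside the
    summands go up by one. Thus it shares its depth with no other point, and points of different
    summands have disjoint nodes.\<close>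
  define N where "N x = (if x \<in> Y then N0 (S x) x else topspace X)" for x
  define d where "d x = (if x \<in> Y then Suc (d0 (S x) x) else 0)" for x
  have inS: "S x \<in> \<F>" "x \<in> S x" if "x \<in> Y" for x
    using that S \<open>\<Union>\<F> = Y\<close> by auto
  have sub: "N x \<subseteq> S x" if "x \<in> Y" for x
  proof -
    have "openin (subtopology X (S x)) (N x)"
      using IH[OF inS(1)[OF that]] inS(2)[OF that] that by (simp add: N_def)
    then show ?thesis using openin_subset top[OF inS(1)[OF that]] by blast
  qed
  have N: "x \<in> N x \<and> clopenin X (N x)" if "x \<in> topspace X" for x
  proof (cases "x \<in> Y")
    case True
    then show ?thesis
      using IH[OF inS(1)[OF True]] inS(2)[OF True] clopenin_trans[OF clop[OF inS(1)[OF True]]]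
      unfolding N_def by metis
  next
    case False
    then show ?thesis using that by (simp add: N_def)
  qed
  have D: "(y \<in> N x \<longrightarrow> x \<notin> N y) \<and> (d x = d y \<longrightarrow> disjnt (N x) (N y))"
    if xy: "x \<in> topspace X" "y \<in> topspace X" "x \<noteq> y" for x y
  proof (cases "x \<in> Y \<and> y \<in> Y")
    case True
    show ?thesis
    proof (cases "S x = S y")
      case True
      then show ?thesis
      proof -
        have Y: "x \<in> Y" "y \<in> Y" using \<open>x \<in> Y \<and> y \<in> Y\<close> by auto
        have "(y \<in> N0 (S x) x \<longrightarrow> x \<notin> N0 (S x) y) \<and>
          (d0 (S x) x = d0 (S x) y \<longrightarrow> disjnt (N0 (S x) x) (N0 (S x) y))"
          using IH[OF inS(1)[OF Y(1)]] inS(2)[OF Y(1)] inS(2)[OF Y(2)] \<open>x \<noteq> y\<close> True by metis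
        then show ?thesis using Y True by (simp add: N_def d_def)
      qed
    next
      case False
      then have "disjnt (S x) (S y)"
        using True inS \<open>pairwise disjnt \<F>\<close> by (simp add: pairwise_def)
      then have "disjnt (N x) (N y)"
        using sub[of x] sub[of y] True by (meson disjnt_subset1 disjnt_subset2)
      then show ?thesis using N[OF xy(1)] by (auto simp: disjnt_iff)
    qed
  next
    case False
    have "x \<in> Y \<or> y \<in> Y"
      using card_le_Suc0_iff_eq[OF alex(6)] alex(7) xy by auto
    then have "d x \<noteq> d y" using False by (auto simp: d_def)
    moreover have "\<not> (y \<in> N x \<and> x \<in> N y)"
      using False \<open>x \<in> Y \<or> y \<in> Y\<close> sub[of x] sub[of y] inS[of x] inS[of y] \<open>\<Union>\<F> = Y\<close> by blast
    ultimately show ?thesis by blast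
  qed
  show ?case using N D by (intro exI[of _ N] exI[of _ d]) blast
qed

section \<open>The weak topology of l2\<close>

lemma topspace_l2_weak [simp]: "topspace l2_weak_topology = l2_space"
proof -
  have "(\<lambda>_. 0) \<in> l2_space" by (simp add: l2_space_def)
  then have "l2_space \<in> {{x \<in> l2_space. l2_inner x y \<in> U} | y U. y \<in> l2_space \<and> open U}"
    by (intro CollectI exI[of _ "\<lambda>_. 0"] exI[of _ UNIV]) auto
  then show ?thesis
    unfolding l2_weak_topology_def topology_generated_by_topspace by blast
qed

lemma l2_inner_summable:
  assumes "x \<in> l2_space" "y \<in> l2_space"
  shows "(\<lambda>i. x i * y i) summable_on UNIV"
proof -
  have "(\<lambda>i. (x i)\<^sup>2 + (y i)\<^sup>2) summable_on UNIV"
    using assms by (intro summable_on_add) (auto simp: l2_space_def)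
  moreover have "norm (x i * y i) \<le> (x i)\<^sup>2 + (y i)\<^sup>2" for i
  proof -
    have "2 * norm (x i * y i) \<le> (x i)\<^sup>2 + (y i)\<^sup>2"
      using sum_squares_bound[of "\<bar>x i\<bar>" "\<bar>y i\<bar>"] by (simp add: abs_mult mult.assoc)
    then show ?thesis using norm_ge_zero[of "x i * y i"] by linarith
  qed
  ultimately have "(\<lambda>i. norm (x i * y i)) summable_on UNIV"
    by (rule Infinite_Sum.abs_summable_on_comparison_test')
  then show ?thesis by (rule Infinite_Sum.abs_summable_summable)
qed

text \<open>Pairing with the unit vector at \<open>i\<close> reads off the coordinate
  \<open>i\<close>, so coordinates are weakly continuous and separate points.\<close>

lemma Hausdorff_l2_weak: "Hausdorff_space (l2_weak_topology :: ('i \<Rightarrow> real) topology)"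
  unfolding Hausdorff_space_def
proof (intro allI impI, elim conjE)
  fix x y :: "'i \<Rightarrow> real"
  assume xy: "x \<in> topspace l2_weak_topology" "y \<in> topspace l2_weak_topology" "x \<noteq> y"
  then obtain i where i: "x i \<noteq> y i" by blast
  define e where "e j = (if j = i then 1 else 0 :: real)" for j
  have "(\<lambda>j. (e j)\<^sup>2) summable_on {i}" by simp
  then have e: "e \<in> l2_space"
    unfolding l2_space_def mem_Collect_eq
    by (rule summable_on_cong_neutral[THEN iffD1, rotated -1]) (auto simp: e_def)
  have inner: "l2_inner z e = z i" for z
  proof -
    have "l2_inner z e = (\<Sum>\<^sub>\<infinity>j\<in>{i}. z j * e j)"
      unfolding l2_inner_def by (rule infsum_cong_neutral) (auto simp: e_def)
    then show ?thesis by (simp add: e_def)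
  qed
  obtain U V where UV: "open U" "open V" "x i \<in> U" "y i \<in> V" "U \<inter> V = {}"
    using hausdorff[OF i] by blast
  have "openin l2_weak_topology {z \<in> l2_space. l2_inner z e \<in> W}" if "open W" for W
    unfolding l2_weak_topology_def by (rule topology_generated_by_Basis) (use e that in blast)
  then show "\<exists>U V. openin l2_weak_topology U \<and> openin l2_weak_topology V \<and> x \<in> U \<and> y \<in> V \<and> disjnt U V"
    using UV xy
    by (intro exI[of _ "{z \<in> l2_space. l2_inner z e \<in> U}"] exI[of _ "{z \<in> l2_space. l2_inner z e \<in> V}"])
      (auto simp: inner disjnt_iff)
qed

text \<open>This bounds the coordinate sums of the embedding, since different nodes through one
  point have different depths.\<close>

lemma sum_geometric_inj_le:
  fixes d :: "'i \<Rightarrow> nat"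
  assumes "finite B" "inj_on d B"
  shows "(\<Sum>i\<in>B. (1/2::real) ^ d i) \<le> 2"
proof -
  have "(\<Sum>i\<in>B. (1/2::real) ^ d i) = (\<Sum>n\<in>d ` B. (1/2) ^ n)"
    using assms by (simp add: sum.reindex)
  also have "\<dots> \<le> (\<Sum>n. (1/2) ^ n)"
    using assms by (intro sum_le_suminf) (auto intro: summable_geometric)
  also have "\<dots> = 2" by (simp add: suminf_geometric)
  finally show ?thesis .
qed

lemma summable_on_nonneg_bounded:
  fixes g :: "'i \<Rightarrow> real"
  assumes "\<And>i. g i \<ge> 0" "\<And>B. finite B \<Longrightarrow> sum g B \<le> C"
  shows "g summable_on UNIV" "infsum g UNIV \<le> C"
proof -
  show "g summable_on UNIV"
    using assms by (intro nonneg_bdd_above_summable_on) (auto simp: bdd_above_def)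
  then show "infsum g UNIV \<le> C"
    using assms(2) infsum_le_finite_sums by blast
qed

text \<open>A square-summable \<open>y\<close> has only finitely many coordinates of size at least
  \<open>\<epsilon>\<close>. On these \<open>f\<close> is constant near \<open>k0\<close>; the
  others change the inner product by at most \<open>\<epsilon>\<close> times the sum of two l1
  norms, that is by at most \<open>2 * \<epsilon> * C\<close>.\<close>

lemma l2_weak_continuous:
  fixes f :: "'a \<Rightarrow> ('i \<Rightarrow> real)"
  assumes nonneg: "\<And>k i. 0 \<le> f k i"
    and l1: "\<And>k B. k \<in> topspace K \<Longrightarrow> finite B \<Longrightarrow> sum (f k) B \<le> C"
    and l2: "\<And>k. k \<in> topspace K \<Longrightarrow> f k \<in> l2_space"
    and loc: "\<And>k i. k \<in> topspace K \<Longrightarrow> openin K {k' \<in> topspace K. f k' i = f k i}"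
  shows "continuous_map K l2_weak_topology f"
  unfolding l2_weak_topology_def
proof (rule continuous_on_generated_topo)
  have "\<Union>{{x \<in> l2_space. l2_inner x y \<in> U} | y U. y \<in> l2_space \<and> open U} = (l2_space :: ('i \<Rightarrow> real) set)"
    using topspace_l2_weak unfolding l2_weak_topology_def topology_generated_by_topspace .
  moreover have "f ` topspace K \<subseteq> l2_space"
    using l2 by blast
  ultimately show "f ` topspace K \<subseteq> \<Union>{{x \<in> l2_space. l2_inner x y \<in> U} | y U. y \<in> l2_space \<and> open U}"
    by (simp only:)
next
  fix W assume "W \<in> {{x \<in> l2_space. l2_inner x y \<in> U} | y U. y \<in> (l2_space :: ('i \<Rightarrow> real) set) \<and> open U}"
  then obtain y :: "'i \<Rightarrow> real" and U where y: "y \<in> l2_space" and U: "open U"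
    and W: "W = {x \<in> l2_space. l2_inner x y \<in> U}" by blast
  have "\<exists>T. openin K T \<and> k0 \<in> T \<and> T \<subseteq> f -` W \<inter> topspace K" if k0: "k0 \<in> topspace K" "f k0 \<in> W" for k0
  proof -
    obtain \<delta> where \<delta>: "\<delta> > 0" "\<And>r. \<bar>r - l2_inner (f k0) y\<bar> < \<delta> \<Longrightarrow> r \<in> U"
      using U k0 W unfolding open_dist dist_real_def by blast
    \<comment> \<open>Using \<open>\<bar>C\<bar> + 1\<close> keeps the denominator positive and
      makes \<open>2 * \<epsilon> * C < \<delta>\<close> strict.\<close>
    define \<epsilon> where "\<epsilon> = \<delta> / (2 * (\<bar>C\<bar> + 1))"
    have \<epsilon>: "\<epsilon> > 0" "2 * \<epsilon> * C < \<delta>"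
    proof -
      show "\<epsilon> > 0" using \<delta> by (simp add: \<epsilon>_def)
      have "2 * \<epsilon> * C < 2 * \<epsilon> * (\<bar>C\<bar> + 1)"
        using \<open>\<epsilon> > 0\<close> by (intro mult_strict_left_mono) auto
      also have "\<dots> = \<delta>"
        using abs_ge_zero[of C] unfolding \<epsilon>_def by (simp add: field_simps)
      finally show "2 * \<epsilon> * C < \<delta>" .
    qed
    define F where "F = {i. \<epsilon> \<le> \<bar>y i\<bar>}"
    have "finite F"
    proof -
      have "(\<lambda>i. (y i)\<^sup>2) summable_on UNIV" using y by (simp add: l2_space_def)
      then have "(\<lambda>i. (y i)\<^sup>2) summable_on F" by (rule summable_on_subset_banach) simp
      then have "(\<lambda>i. norm (\<epsilon>\<^sup>2)) summable_on F"
        by (rule Infinite_Sum.abs_summable_on_comparison_test')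
          (use \<epsilon> in \<open>auto simp: F_def abs_le_square_iff[symmetric]\<close>)
      then show ?thesis
        using \<epsilon> infsum_diverge_constant[of F "norm (\<epsilon>\<^sup>2)"] by fastforce
    qed
    \<comment> \<open>The extra intersection with \<open>topspace K\<close> covers the case of empty
      \<open>F\<close>, where the indexed intersection is the whole type.\<close>
    define T where "T = (\<Inter>i\<in>F. {k' \<in> topspace K. f k' i = f k0 i}) \<inter> topspace K"
    have T: "openin K T"
      unfolding T_def using \<open>finite F\<close> loc k0 by (cases "F = {}") (auto intro!: openin_Int openin_INT)
    moreover have "k0 \<in> T" using k0 by (simp add: T_def)
    moreover have "f k \<in> W" if "k \<in> T" for k
    proof -
      have k: "k \<in> topspace K" and eq: "\<And>i. i \<in> F \<Longrightarrow> f k i = f k0 i"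
        using that by (auto simp: T_def)
      let ?t = "\<lambda>i. f k i * y i - f k0 i * y i"
      have s: "(\<lambda>i. f k i * y i) summable_on UNIV" "(\<lambda>i. f k0 i * y i) summable_on UNIV"
        using l2 k k0 y by (auto intro: l2_inner_summable)
      have st: "?t summable_on UNIV"
        using summable_on_add[OF s(1) summable_on_uminus[THEN iffD2, OF s(2)]] by simp
      have f: "f k' summable_on UNIV" "infsum (f k') UNIV \<le> C" if "k' \<in> topspace K" for k'
        using summable_on_nonneg_bounded[of "f k'" C] nonneg l1[OF that] by auto
      have "l2_inner (f k) y - l2_inner (f k0) y = infsum ?t UNIV"
        unfolding l2_inner_def
        using infsum_add[OF st s(2)] by simp
      also have "\<bar>\<dots>\<bar> \<le> infsum (\<lambda>i. \<epsilon> * (f k i + f k0 i)) UNIV"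
      proof -
        have b: "norm (?t i) \<le> \<epsilon> * (f k i + f k0 i)" for i
        proof (cases "i \<in> F")
          case True
          then show ?thesis using eq nonneg \<epsilon> by simp
        next
          case False
          then have "\<bar>y i\<bar> \<le> \<epsilon>" by (simp add: F_def)
          moreover have "\<bar>f k i - f k0 i\<bar> \<le> f k i + f k0 i"
            using nonneg[of k i] nonneg[of k0 i] by linarith
          ultimately have "\<bar>f k i - f k0 i\<bar> * \<bar>y i\<bar> \<le> (f k i + f k0 i) * \<epsilon>"
            using nonneg by (intro mult_mono) auto
          then show ?thesis by (simp add: abs_mult[symmetric] algebra_simps)
        qed
        have "((\<lambda>i. \<epsilon> * (f k i + f k0 i)) has_sum infsum (\<lambda>i. \<epsilon> * (f k i + f k0 i)) UNIV) UNIV"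
          using f k k0 by (intro has_sum_infsum summable_on_cmult_right summable_on_add) auto
        moreover have "(?t has_sum infsum ?t UNIV) UNIV"
          using st by (rule has_sum_infsum)
        ultimately show ?thesis using b
          by (metis (no_types, lifting) norm_has_sum_bound real_norm_def has_sum_infsum norm_infsum_le UNIV_I)
      qed
      also have "\<dots> = \<epsilon> * (infsum (f k) UNIV + infsum (f k0) UNIV)"
        using f k k0 by (subst infsum_cmult_right) (auto simp: infsum_add intro: summable_on_add)
      also have "\<dots> \<le> \<epsilon> * (C + C)"
        using f k k0 \<epsilon> by (intro mult_left_mono add_mono) auto
      also have "\<dots> < \<delta>" using \<epsilon>(2) by (simp add: algebra_simps)
      finally have "l2_inner (f k) y \<in> U" by (rule \<delta>(2))
      then show ?thesis using W l2 k by simp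
    qed
    ultimately show ?thesis using k0 T openin_subset[OF T]
      by (intro exI[of _ T]) auto
  qed
  then show "openin K (f -` W \<inter> topspace K)"
    by (subst openin_subopen) blast
qed

text \<open>Coordinates are indexed by the points of \<open>K\<close>, one node for each, so l2 over
  the point type is large enough. A continuous injection from a compact space into a Hausdorff space
  is an embedding.\<close>

lemma classA_imp_uniform_Eberlein:
  fixes K :: "'a topology"
  assumes "classA K"
  shows "uniform_Eberlein K"
proof -
  obtain N :: "'a \<Rightarrow> 'a set" and d :: "'a \<Rightarrow> nat"
    where Nd: "\<forall>x\<in>topspace K. x \<in> N x \<and> clopenin K (N x)"
      "\<forall>x\<in>topspace K. \<forall>y\<in>topspace K. x \<noteq> y \<longrightarrow>
         (y \<in> N x \<longrightarrow> x \<notin> N y) \<and> (d x = d y \<longrightarrow> disjnt (N x) (N y))"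
    using classA_tree_marking[OF assms] by (elim exE conjE) (rule that)
  then have N: "\<And>x. x \<in> topspace K \<Longrightarrow> x \<in> N x" "\<And>x. x \<in> topspace K \<Longrightarrow> clopenin K (N x)"
    and asym: "\<And>x y. \<lbrakk>x \<in> topspace K; y \<in> topspace K; x \<noteq> y; y \<in> N x\<rbrakk> \<Longrightarrow> x \<notin> N y"
    and disj: "\<And>x y. \<lbrakk>x \<in> topspace K; y \<in> topspace K; x \<noteq> y; d x = d y\<rbrakk> \<Longrightarrow> disjnt (N x) (N y)"
    by metis+
  define f where "f k i = (if i \<in> topspace K \<and> k \<in> N i then (1/2::real) ^ d i else 0)" for k i
  have le2: "sum (f k) B \<le> 2" if "finite B" for k B
  proof -
    let ?B = "{i \<in> B. i \<in> topspace K \<and> k \<in> N i}"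
    have "inj_on d ?B"
      using disj by (auto simp: inj_on_def disjnt_iff)
    then have "(\<Sum>i\<in>?B. (1/2::real) ^ d i) \<le> 2"
      using that by (intro sum_geometric_inj_le) auto
    then show ?thesis unfolding f_def using that by (simp add: sum.inter_filter)
  qed
  have nonneg: "0 \<le> f k i" for k i by (simp add: f_def)
  have l2: "f k \<in> l2_space" for k
  proof -
    have "(f k i)\<^sup>2 \<le> f k i" for i
      by (auto simp: f_def power2_eq_square power_le_one mult_left_le)
    then have "(\<Sum>i\<in>B. (f k i)\<^sup>2) \<le> 2" if "finite B" for B
      using le2[OF that, of k] by (meson order_trans sum_mono)
    then show ?thesis unfolding l2_space_def
      using summable_on_nonneg_bounded(1)[of "\<lambda>i. (f k i)\<^sup>2" 2] by simp
  qed
  have "continuous_map K l2_weak_topology f"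
  proof (rule l2_weak_continuous[where C = 2])
    fix k i assume k: "k \<in> topspace K"
    show "openin K {k' \<in> topspace K. f k' i = f k i}"
    proof (cases "i \<in> topspace K")
      case True
      have "{k' \<in> topspace K. f k' i = f k i} = (if k \<in> N i then N i else topspace K - N i)"
        using True N(2)[OF True] openin_subset[of K "N i"] by (auto simp: f_def)
      then show ?thesis using N(2)[OF True] by (simp add: openin_diff)
    next
      case False
      then show ?thesis by (simp add: f_def)
    qed
  qed (use nonneg le2 l2 in auto)
  moreover have "inj_on f (topspace K)"
  proof (rule inj_onI, rule ccontr)
    fix x y assume xy: "x \<in> topspace K" "y \<in> topspace K" "f x = f y" "x \<noteq> y"
    \<comment> \<open>The coordinate of a point at itself is nonzero. Equal images would therefore
      place \<open>x\<close> and \<open>y\<close> in each other's nodes, against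
      \<open>asym\<close>.\<close>
    have "f z z \<noteq> 0" if "z \<in> topspace K" for z using that N(1) by (simp add: f_def)
    then have "f y x \<noteq> 0" "f x y \<noteq> 0" using xy by metis+
    then have "y \<in> N x" "x \<in> N y" by (auto simp: f_def split: if_splits)
    then show False using asym xy by blast
  qed
  ultimately have "embedding_map K l2_weak_topology f"
    using assms classA_imp_compact_space Hausdorff_l2_weak continuous_imp_embedding_map by blast
  then show ?thesis
    using assms classA_imp_compact_space unfolding uniform_Eberlein_def by blast
qed

section \<open>Compactifications of scattered metrizable spaces\<close>

text \<open>Points are subsets of \<open>I\<close> instead of Boolean functions, so that a cube over
  a family of subsets of \<open>'a\<close> has points of type \<open>'a set set\<close>, the type
  required of the compactification. The topology is transported along characteristic
  functions.\<close>

definition cantor_cube :: "'i set \<Rightarrow> 'i set topology" where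
  "cantor_cube I = pullback_topology (Pow I) (\<lambda>S. \<lambda>i\<in>I. i \<in> S)
     (product_topology (\<lambda>_. discrete_topology UNIV) I)"

lemma topspace_cantor_cube [simp]: "topspace (cantor_cube I) = Pow I"
  by (auto simp: cantor_cube_def topspace_pullback_topology)

lemma homeomorphic_cantor_cube:
  "cantor_cube I homeomorphic_space product_topology (\<lambda>_. discrete_topology (UNIV :: bool set)) I"
proof -
  let ?P = "product_topology (\<lambda>_. discrete_topology (UNIV :: bool set)) I"
  let ?f = "\<lambda>S. \<lambda>i\<in>I. i \<in> S" and ?g = "\<lambda>h. {i \<in> I. h i}"
  have fg: "?f (?g h) = h" if "h \<in> topspace ?P" for h
    using that by (intro extensionalityI[of _ I]) (simp_all add: PiE_def)
  have "continuous_map (cantor_cube I) ?P ?f"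
    using continuous_map_pullback[OF continuous_map_id, of "Pow I" ?f ?P]
    by (simp add: cantor_cube_def)
  moreover have "continuous_map ?P (cantor_cube I) ?g"
    unfolding cantor_cube_def
  proof (rule continuous_map_pullback')
    show "continuous_map ?P ?P (?f \<circ> ?g)"
      by (rule continuous_map_eq[OF continuous_map_id]) (use fg in simp)
  qed auto
  moreover have "?g (?f S) = S" if "S \<in> topspace (cantor_cube I)" for S using that by auto
  ultimately have "homeomorphic_maps (cantor_cube I) ?P ?f ?g"
    using fg unfolding homeomorphic_maps_def by blast
  then show ?thesis by (auto simp: homeomorphic_space_def)
qed

lemma compact_cantor_cube: "compact_space (cantor_cube I)"
  using homeomorphic_compact_space[OF homeomorphic_cantor_cube]
  by (simp add: compact_space_product_topology compact_space_discrete_topology)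

lemma Hausdorff_cantor_cube: "Hausdorff_space (cantor_cube I)"
  using homeomorphic_Hausdorff_space[OF homeomorphic_cantor_cube]
  by (simp add: Hausdorff_space_product_topology)

lemma clopenin_cantor_cube_coordinate:
  assumes "i \<in> I"
  shows "clopenin (cantor_cube I) {S \<in> Pow I. i \<in> S}"
proof -
  let ?P = "product_topology (\<lambda>_. discrete_topology (UNIV :: bool set)) I"
  have "continuous_map (cantor_cube I) ?P (\<lambda>S. \<lambda>i\<in>I. i \<in> S)"
    using continuous_map_pullback[OF continuous_map_id, of "Pow I" "\<lambda>S. \<lambda>i\<in>I. i \<in> S" ?P]
    by (simp add: cantor_cube_def)
  then have "continuous_map (cantor_cube I) (discrete_topology UNIV) ((\<lambda>h. h i) \<circ> (\<lambda>S. \<lambda>i\<in>I. i \<in> S))"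
    by (rule continuous_map_compose[OF _ continuous_map_product_projection[OF assms]])
  then have c: "continuous_map (cantor_cube I) (discrete_topology UNIV) (\<lambda>S. i \<in> S)"
    using assms by (simp add: o_def)
  show ?thesis
    using openin_continuous_map_preimage[OF c, of "{True}"]
      closedin_continuous_map_preimage[OF c, of "{True}"] by simp
qed

lemma continuous_map_into_cantor_cube:
  assumes "\<And>i. i \<in> I \<Longrightarrow> clopenin X {x \<in> topspace X. i \<in> f x}" "\<And>x. x \<in> topspace X \<Longrightarrow> f x \<subseteq> I"
  shows "continuous_map X (cantor_cube I) f"
  unfolding cantor_cube_def
proof (rule continuous_map_pullback')
  have "continuous_map X (discrete_topology UNIV) (\<lambda>x. i \<in> f x)" if "i \<in> I" for i
    unfolding continuous_map_def
  proof (intro conjI allI impI)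
    fix U :: "bool set"
    have t: "openin X {x \<in> topspace X. i \<in> f x}" "openin X {x \<in> topspace X. i \<notin> f x}"
      using assms(1)[OF that] by (auto simp: closedin_def set_diff_eq Collect_conj_eq cong: conj_cong
          elim!: back_subst[of "openin X"])
    have "{x \<in> topspace X. (i \<in> f x) \<in> U} = (if True \<in> U then {x \<in> topspace X. i \<in> f x} else {}) \<union>
        (if False \<in> U then {x \<in> topspace X. i \<notin> f x} else {})"
      by (auto; metis (full_types))
    then show "openin X {x \<in> topspace X. (i \<in> f x) \<in> U}" using t by (auto intro: openin_Un)
  qed auto
  then show "continuous_map X (product_topology (\<lambda>_. discrete_topology UNIV) I) ((\<lambda>S. \<lambda>i\<in>I. i \<in> S) \<circ> f)"
    by (auto simp: continuous_map_componentwise o_def)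
qed (use assms in auto)

text \<open>A point goes to the set of nodes containing it. Points of the closure are upward closed,
  pairwise intersecting sets of nodes containing the root, hence branches. Well-foundedness allows
  an induction from smaller nodes to larger ones: apart from the branch ending at \<open>M\<close>,
  the part of \<open>K\<close> over \<open>M\<close> is the disjoint union of the parts over the
  children of \<open>M\<close>.\<close>

lemma node_tree_compactification:
  fixes X :: "'a topology"
  assumes "Hausdorff_space X" and tree: "node_tree X (topspace X) \<N>"
  shows "\<exists>(K :: 'a set set topology) e. compactification X K e \<and> classA K"
proof -
  note tree' = tree[unfolded node_tree_def]
  have root: "topspace X \<in> \<N>" using tree' by simp
  have clop: "clopenin X N" "N \<noteq> {}" "N \<subseteq> topspace X" if "N \<in> \<N>" for N
    using tree' that by simp_all
  have nested: "M \<subseteq> N \<or> N \<subseteq> M \<or> M \<inter> N = {}" if "M \<in> \<N>" "N \<in> \<N>" for M N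
    using tree' that by simp
  have minimal: "\<exists>M\<in>\<Q>. \<forall>N\<in>\<Q>. \<not> N \<subset> M" if "\<Q> \<subseteq> \<N>" "\<Q> \<noteq> {}" for \<Q>
    using tree' that by simp
  have finsup: "finite {M \<in> \<N>. N \<subseteq> M}" if "N \<in> \<N>" for N
    using tree' that by simp
  have base: "\<exists>N\<in>\<N>. \<exists>\<F>\<subseteq>\<N>. finite \<F> \<and> x \<in> N - \<Union>\<F> \<and> N - \<Union>\<F> \<subseteq> U"
    if "openin X U" "x \<in> U" "x \<in> topspace X" for U x
    using tree' that by simp
  define e where "e x = {N \<in> \<N>. x \<in> N}" for x
  let ?C = "cantor_cube \<N>"
  define K where "K = subtopology ?C (?C closure_of (e ` topspace X))"
  have e_sub: "e ` topspace X \<subseteq> topspace ?C" by (auto simp: e_def)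
  have topK: "topspace K = ?C closure_of (e ` topspace X)"
    unfolding K_def using closure_of_subset_topspace by (metis topspace_subtopology_subset)
  have e_in: "e ` topspace X \<subseteq> topspace K"
    unfolding topK by (rule closure_of_subset[OF e_sub])
  have K_sub: "S \<subseteq> \<N>" if "S \<in> topspace K" for S
    using that closure_of_subset_topspace[of ?C] unfolding topK by fastforce
  have compK: "compact_space K"
    unfolding K_def by (simp add: closedin_compact_space compact_cantor_cube compact_space_subtopology)
  have hausK: "Hausdorff_space K"
    unfolding K_def by (rule Hausdorff_space_subtopology[OF Hausdorff_cantor_cube])
  have coord: "clopenin ?C {S \<in> Pow \<N>. N \<in> S}" if "N \<in> \<N>" for N
    using that by (rule clopenin_cantor_cube_coordinate)
  have basic: "openin ?C {S \<in> Pow \<N>. N \<in> S \<and> S \<inter> \<B> = {}}"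
    if "N \<in> \<N>" "\<B> \<subseteq> \<N>" "finite \<B>" for N \<B>
  proof -
    have "closedin ?C (\<Union>B\<in>\<B>. {S \<in> Pow \<N>. B \<in> S})"
      using that coord by (intro closedin_Union) auto
    then have "openin ?C ({S \<in> Pow \<N>. N \<in> S} - (\<Union>B\<in>\<B>. {S \<in> Pow \<N>. B \<in> S}))"
      using coord[OF that(1)] by (simp add: openin_diff)
    moreover have "{S \<in> Pow \<N>. N \<in> S} - (\<Union>B\<in>\<B>. {S \<in> Pow \<N>. B \<in> S}) = {S \<in> Pow \<N>. N \<in> S \<and> S \<inter> \<B> = {}}"
      by blast
    ultimately show ?thesis by simp
  qed
  \<comment> \<open>An open condition that holds at a point of \<open>K\<close> already holds at
    some \<open>e x\<close>. The properties \<open>up\<close>, \<open>linked\<close> and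
    \<open>root_in\<close> of arbitrary points of \<open>K\<close> are read off from actual points
    of \<open>X\<close> in this way.\<close>
  have approx: "\<exists>x\<in>topspace X. e x \<in> W" if "openin ?C W" "S \<in> W" "S \<in> topspace K" for S W
    using that unfolding topK in_closure_of by blast
  have up: "M \<in> S" if S: "S \<in> topspace K" "N \<in> S" "M \<in> \<N>" "N \<subseteq> M" for S M N
  proof (rule ccontr)
    assume "M \<notin> S"
    have "N \<in> \<N>" "S \<in> Pow \<N>" using that K_sub by blast+
    have op: "openin ?C {S \<in> Pow \<N>. N \<in> S \<and> S \<inter> {M} = {}}"
      by (rule basic) (use that \<open>N \<in> \<N>\<close> in auto)
    have "S \<in> {S \<in> Pow \<N>. N \<in> S \<and> S \<inter> {M} = {}}"
      using S(2) \<open>M \<notin> S\<close> \<open>S \<in> Pow \<N>\<close> by simp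
    from approx[OF op this S(1)] obtain x where "e x \<in> {S \<in> Pow \<N>. N \<in> S \<and> S \<inter> {M} = {}}" ..
    then show False using that by (auto simp: e_def)
  qed
  have linked: "M \<inter> N \<noteq> {}" if S: "S \<in> topspace K" "M \<in> S" "N \<in> S" for S M N
  proof -
    have MN: "M \<in> \<N>" "N \<in> \<N>" "S \<in> Pow \<N>" "M \<in> S" "N \<in> S" using that K_sub by blast+
    have op: "openin ?C ({S \<in> Pow \<N>. M \<in> S} \<inter> {S \<in> Pow \<N>. N \<in> S})"
      using coord MN by (simp add: openin_Int)
    have "S \<in> {S \<in> Pow \<N>. M \<in> S} \<inter> {S \<in> Pow \<N>. N \<in> S}"
      using MN by simp
    from approx[OF op this S(1)] obtain x where "e x \<in> {S \<in> Pow \<N>. M \<in> S} \<inter> {S \<in> Pow \<N>. N \<in> S}" ..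
    then show ?thesis by (auto simp: e_def)
  qed
  have root_in: "topspace X \<in> S" if S: "S \<in> topspace K" for S
  proof (rule ccontr)
    assume "topspace X \<notin> S"
    have op: "openin ?C (Pow \<N> - {S \<in> Pow \<N>. topspace X \<in> S})"
      using coord[OF root] openin_diff[of ?C "Pow \<N>"] openin_topspace[of ?C] by simp
    have "S \<in> Pow \<N> - {S \<in> Pow \<N>. topspace X \<in> S}"
      using \<open>topspace X \<notin> S\<close> K_sub[OF S] by simp
    from approx[OF op this S] obtain x
      where "x \<in> topspace X" "e x \<in> Pow \<N> - {S \<in> Pow \<N>. topspace X \<in> S}" ..
    then show False using root by (auto simp: e_def)
  qed
  have conte: "continuous_map X ?C e"
  proof (rule continuous_map_into_cantor_cube)
    fix N assume N: "N \<in> \<N>"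
    have "{x \<in> topspace X. N \<in> e x} = N" using clop(3)[OF N] N by (auto simp: e_def)
    then show "clopenin X {x \<in> topspace X. N \<in> e x}" using clop(1)[OF N] by simp
  qed (auto simp: e_def)
  have inje: "inj_on e (topspace X)"
  proof (rule inj_onI, rule ccontr)
    fix x y assume xy: "x \<in> topspace X" "y \<in> topspace X" "e x = e y" "x \<noteq> y"
    obtain U where U: "openin X U" "x \<in> U" "y \<notin> U"
      using assms(1) xy unfolding Hausdorff_space_def disjnt_iff by metis
    obtain N \<F> where N: "N \<in> \<N>" "\<F> \<subseteq> \<N>" "x \<in> N - \<Union>\<F>" "N - \<Union>\<F> \<subseteq> U"
      using base[OF U(1,2) xy(1)] by blast
    have "z \<in> N \<longleftrightarrow> N \<in> e z" "z \<in> \<Union>\<F> \<longleftrightarrow> \<F> \<inter> e z \<noteq> {}" for z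
      using N(1,2) by (auto simp: e_def)
    then have "y \<in> N - \<Union>\<F>" using N(3) xy(3) by simp
    then show False using N(4) U(3) by blast
  qed
  have "homeomorphic_map X (subtopology K (e ` topspace X)) e"
  proof (rule bijective_open_imp_homeomorphic_map)
    have sub: "subtopology K (e ` topspace X) = subtopology ?C (e ` topspace X)"
      unfolding K_def using e_in unfolding topK by (simp add: subtopology_subtopology inf.absorb2)
    show "continuous_map X (subtopology K (e ` topspace X)) e"
      unfolding sub using conte by (simp add: continuous_map_in_subtopology)
    show "e ` topspace X = topspace (subtopology K (e ` topspace X))"
      using e_in by (metis topspace_subtopology_subset)
    show "inj_on e (topspace X)" by (rule inje)
    show "open_map X (subtopology K (e ` topspace X)) e"
      unfolding open_map_def sub
    proof (intro allI impI)
      fix U assume U: "openin X U"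
      have UX: "U \<subseteq> topspace X" using U by (rule openin_subset)
      have "\<exists>T. openin (subtopology ?C (e ` topspace X)) T \<and> y \<in> T \<and> T \<subseteq> e ` U" if y: "y \<in> e ` U" for y
      proof -
        obtain x where x: "x \<in> U" "y = e x" using y by blast
        obtain N \<F> where N: "N \<in> \<N>" "\<F> \<subseteq> \<N>" "finite \<F>" "x \<in> N - \<Union>\<F>" "N - \<Union>\<F> \<subseteq> U"
          using base[OF U x(1)] x(1) UX by blast
        \<comment> \<open>The set \<open>N - \<Union>\<F>\<close> from the base clause corresponds
          under \<open>e\<close> to the trace of a basic open set of the cube; this makes
          \<open>e\<close> open onto its image.\<close>
        let ?T = "e ` topspace X \<inter> {S \<in> Pow \<N>. N \<in> S \<and> S \<inter> \<F> = {}}"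
        have "openin (subtopology ?C (e ` topspace X)) ?T"
          using basic[OF N(1-3)] by (rule openin_subtopology_Int2)
        moreover have "y \<in> ?T" using x UX N(1,4) by (auto simp: e_def)
        moreover have "?T \<subseteq> e ` U"
        proof
          fix S assume "S \<in> ?T"
          then obtain z where "S = e z" "N \<in> e z" "e z \<inter> \<F> = {}" by blast
          then have "z \<in> N - \<Union>\<F>" using N(2) by (auto simp: e_def)
          then show "S \<in> e ` U" using N(5) \<open>S = e z\<close> by blast
        qed
        ultimately show ?thesis by blast
      qed
      then show "openin (subtopology ?C (e ` topspace X)) (e ` U)"
        by (subst openin_subopen) blast
    qed
  qed
  then have emb: "embedding_map X K e" by (simp add: embedding_map_def)
  have dense: "K closure_of (e ` topspace X) = topspace K"
    unfolding topK unfolding K_def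
    by (simp add: closure_of_subtopology inf.absorb2 closure_of_subset[OF e_sub])
  \<comment> \<open>\<open>hat N\<close> is the clopen extension of \<open>N\<close> to
    \<open>K\<close>, that is, the closure of the image of \<open>N\<close>.\<close>
  define hat where "hat N = {S \<in> topspace K. N \<in> S}" for N
  have hat_clop: "clopenin K (hat N)" if "N \<in> \<N>" for N
  proof -
    have "hat N = topspace K \<inter> {S \<in> Pow \<N>. N \<in> S}" using K_sub by (auto simp: hat_def)
    then show ?thesis
      using coord[OF that] unfolding topK unfolding K_def
      by (simp add: openin_subtopology_Int2 closedin_subtopology_Int_closed)
  qed
  have "classA (subtopology K (hat N))" if "N \<in> \<N>" for N
  proof (rule ccontr)
    assume "\<not> ?thesis"
    then have "{N \<in> \<N>. \<not> classA (subtopology K (hat N))} \<noteq> {}" using that by blast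
    then obtain M where M: "M \<in> \<N>" "\<not> classA (subtopology K (hat M))"
      and small: "\<And>N. N \<in> \<N> \<Longrightarrow> N \<subset> M \<Longrightarrow> classA (subtopology K (hat N))"
      using minimal[of "{N \<in> \<N>. \<not> classA (subtopology K (hat N))}"] by blast
    \<comment> \<open>\<open>p\<close> is the branch ending at \<open>M\<close>; it need not belong to \<open>K\<close>, namely when finitely many
      children cover \<open>M\<close>.\<close>
    define p where "p = {N \<in> \<N>. M \<subseteq> N}"
    \<comment> \<open>The children of \<open>M\<close>: the maximal nodes strictly inside
      \<open>M\<close>.\<close>
    define ch where "ch = {N \<in> \<N>. N \<subset> M \<and> (\<forall>L\<in>\<N>. N \<subseteq> L \<and> L \<subset> M \<longrightarrow> L = N)}"
    have chN: "N \<in> \<N>" "N \<subset> M" if "N \<in> ch" for N using that by (simp_all add: ch_def)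
    have un: "\<Union>(hat ` ch) = hat M - {p}"
    proof
      show "\<Union>(hat ` ch) \<subseteq> hat M - {p}"
      proof
        fix S assume "S \<in> \<Union>(hat ` ch)"
        then obtain N where N: "N \<in> ch" "S \<in> topspace K" "N \<in> S" by (auto simp: hat_def)
        then have "M \<in> S" using up[of S N M] chN[of N] M(1) by blast
        moreover have "S \<noteq> p" using N(3) chN(2)[OF N(1)] by (auto simp: p_def)
        ultimately show "S \<in> hat M - {p}" using N(2) by (simp add: hat_def)
      qed
      show "hat M - {p} \<subseteq> \<Union>(hat ` ch)"
      proof
        fix S assume "S \<in> hat M - {p}"
        then have S: "S \<in> topspace K" "M \<in> S" "S \<noteq> p" by (simp_all add: hat_def)
        have "p \<subseteq> S" using up[OF S(1,2)] by (auto simp: p_def)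
        then obtain N where N: "N \<in> S" "\<not> M \<subseteq> N" using S(3) K_sub[OF S(1)] by (auto simp: p_def)
        have "N \<in> \<N>" using N(1) K_sub[OF S(1)] by blast
        \<comment> \<open>By \<open>linked\<close> the two nodes intersect, so nestedness leaves
          only strict inclusion. As \<open>N\<close> has finitely many ancestors, one of those
          strictly inside \<open>M\<close> is maximal; it is a child of \<open>M\<close> and belongs
          to \<open>S\<close> by \<open>up\<close>.\<close>
        then have "N \<subset> M" using nested[of N M] M(1) linked[OF S(1) N(1) S(2)] N(2) by blast
        let ?Q = "{L \<in> \<N>. N \<subseteq> L \<and> L \<subset> M}"
        have "finite ?Q" using finsup[OF \<open>N \<in> \<N>\<close>] by (rule rev_finite_subset) blast
        moreover have "N \<in> ?Q" using \<open>N \<in> \<N>\<close> \<open>N \<subset> M\<close> by blast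
        ultimately obtain L where L: "L \<in> ?Q" "\<And>L'. L' \<in> ?Q \<Longrightarrow> L \<subseteq> L' \<Longrightarrow> L = L'"
          using finite_has_maximal2 by (metis (no_types, lifting))
        have "L \<in> ch"
          unfolding ch_def using L(1) by (auto intro!: L(2)[symmetric])
        moreover have "L \<in> S" using up[OF S(1) N(1)] L(1) by blast
        ultimately show "S \<in> \<Union>(hat ` ch)" using S(1) by (auto simp: hat_def)
      qed
    qed
    have disj: "pairwise disjnt (hat ` ch)"
    proof (rule pairwiseI)
      fix P Q assume "P \<in> hat ` ch" "Q \<in> hat ` ch" "P \<noteq> Q"
      then obtain N L where NL: "N \<in> ch" "L \<in> ch" "P = hat N" "Q = hat L" "N \<noteq> L" by blast
      show "disjnt P Q"
      proof (rule ccontr)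
        assume "\<not> disjnt P Q"
        then obtain S where "S \<in> topspace K" "N \<in> S" "L \<in> S"
          unfolding NL disjnt_iff hat_def by blast
        then have "N \<inter> L \<noteq> {}" by (rule linked)
        then have "N \<subseteq> L \<or> L \<subseteq> N" using nested chN(1) NL by blast
        then show False using NL(1,2,5) by (auto simp: ch_def)
      qed
    qed
    have cl: "openin K D \<and> classA (subtopology K D)" if "D \<in> hat ` ch" for D
      using that hat_clop small chN by auto
    have "classA (subtopology K (hat M))"
    proof (cases "p \<in> hat M")
      case True
      then show ?thesis
        by (rule classA_clopen_insert_point[OF compK hausK hat_clop[OF M(1)] _ un disj cl])
    next
      case False
      then have "\<Union>(hat ` ch) = hat M" using un by blast
      then show ?thesis
        by (rule classA_clopen_Union[OF compK hausK hat_clop[OF M(1)] _ disj cl])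
    qed
    then show False using M(2) by blast
  qed
  from this[OF root] have "classA (subtopology K (hat (topspace X)))" .
  moreover have "hat (topspace X) = topspace K" using root_in by (auto simp: hat_def)
  ultimately have "classA K" by simp
  then show ?thesis
    using compK hausK emb dense unfolding compactification_def by blast
qed

lemma scattered_metrizable_compactification:
  fixes X :: "'a topology"
  assumes "scattered_space X" "metrizable_space X"
  shows "\<exists>(K :: 'a set set topology) e. compactification X K e \<and> classA K"
proof (cases "topspace X = {}")
  \<comment> \<open>Nodes are nonempty, so the empty space has no tree and is compactified by the
    empty space directly.\<close>
  case True
  have "embedding_map X (discrete_topology ({} :: 'a set set set)) (\<lambda>_. {})"
    using True by (simp add: embedding_map_def homeomorphic_map_def quotient_map_def)
  then have "compactification X (discrete_topology ({} :: 'a set set set)) (\<lambda>_. {})"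
    using True by (simp add: compactification_def compact_space_discrete_topology)
  moreover have "classA (discrete_topology ({} :: 'a set set set))" by (rule classA.empty) simp
  ultimately show ?thesis by blast
next
  case False
  obtain M d where "Metric_space M d" and X: "X = Metric_space.mtopology M d"
    using assms(2) unfolding metrizable_space_def by blast
  then interpret Metric_space M d by simp
  have "M \<noteq> {}" using False X by simp
  then obtain \<N> where "node_tree X (topspace X) \<N>"
    using scattered_node_tree assms(1) X by auto
  moreover have "Hausdorff_space X" using X Hausdorff_space_mtopology by simp
  ultimately show ?thesis using node_tree_compactification by blast
qed

theorem theorem3:
  shows "(\<forall>X :: 'a topology. scattered_space X \<and> metrizable_space X \<longrightarrow>
            (\<exists>(K :: 'a set set topology) e. compactification X K e \<and>
                scattered_space K \<and> hereditarily_paracompact K))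
       \<and> (\<forall>K :: 'b topology. compact_space K \<and> Hausdorff_space K \<and>
            scattered_space K \<and> hereditarily_paracompact K \<longrightarrow> uniform_Eberlein K)
       \<and> (\<forall>X :: 'c topology. compact_space X \<and> Hausdorff_space X \<longrightarrow>
            (scattered_space X \<and> hereditarily_paracompact X \<longleftrightarrow> classA X))"
proof (intro conjI allI impI)
  fix X :: "'a topology" assume "scattered_space X \<and> metrizable_space X"
  then obtain K :: "'a set set topology" and e where K: "compactification X K e" "classA K"
    using scattered_metrizable_compactification by blast
  then have "Hausdorff_space K" by (simp add: compactification_def)
  then show "\<exists>(K :: 'a set set topology) e. compactification X K e \<and>
      scattered_space K \<and> hereditarily_paracompact K"
    using K classA_imp_scattered classA_imp_hereditarily_paracompact by blast
next
  fix K :: "'b topology"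
  assume "compact_space K \<and> Hausdorff_space K \<and> scattered_space K \<and> hereditarily_paracompact K"
  then show "uniform_Eberlein K"
    using scattered_hereditarily_paracompact_imp_classA classA_imp_uniform_Eberlein by blast
next
  fix X :: "'c topology" assume "compact_space X \<and> Hausdorff_space X"
  then show "scattered_space X \<and> hereditarily_paracompact X \<longleftrightarrow> classA X"
    using scattered_hereditarily_paracompact_imp_classA classA_imp_scattered
      classA_imp_hereditarily_paracompact by blast
qed

end
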